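(* Let $F$ be a field. The multiplication group of the Paige loop $M^*(F)$ is (isomorphic to) the simple group $P\Omega(\mathbb O(F),N)=P\Omega^+_8(F)$.
   Context: For a field $F$, the split octonion algebra $\mathbb O(F)$ is the Zorn vector matrix algebra: its elements are $\left(\begin{array}{cc}a&\alpha\\ \beta&b\end{array}\right)$ with $a,b\in F$, $\alpha,\beta\in F^3$, added componentwise and multiplied by $$\left(\begin{array}{cc}a&\alpha\\ \beta&b\end{array}\right)\left(\begin{array}{cc}c&\gamma\\ \delta&d\end{array}\right)=\left(\begin{array}{cc}ac+\alpha\cdot\delta& a\gamma+d\alpha-\beta\times\delta\\ c\beta+b\delta+\alpha\times\gamma&\beta\cdot\gamma+bd\end{array}\right),$$ with the usual dot and cross products on $F^3$. The norm $N$ is $\left(\begin{array}{cc}a&\alpha\\ \beta&b\end{array}\right)\mapsto ab-\alpha\cdot\beta$, a non-degenerate multiplicative quadratic form of (maximal) Witt index $4$. $M(F)$ is the Moufang loop of all elements of norm $1$, $Z$ is its center ($Z=\{e\}$ if $\mathrm{char}\,F=2$ and $Z=\{e,-e\}$ otherwise, $e$ being the identity element), and the Paige loop is $M^*(F)=M(F)/Z$. The multiplication group $\mathrm{Mlt}(Q)$ of a loop $Q$ is the permutation group generated by all left translations $L_x:y\mapsto xy$ and right translations $R_x:y\mapsto yx$, $x\in Q$. For a vector space $V$ with non-degenerate quadratic form $N$, $O(V,N)$ is the group of linear transformations preserving $N$, $\Omega(V,N)$ is the commutator subgroup of $O(V,N)$. For $V=\mathbb O(F)$, $P\Omega(V,N)=\Omega(V,N)/\{\pm\mathrm{id}\}$;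 it is written $P\Omega_8^+(F)$ because $N$ has maximal Witt index in dimension $8$. *)

theory Defs
  imports "HOL-Analysis.Cartesian_Space" "HOL-Algebra.Bij" "HOL-Algebra.Generated_Groups"
begin

section \<open>Loops and groups\<close>

text \<open>A loop is represented by its \<open>monoid\<close> record; associativity is never assumed.\<close>

definition loop_center :: "('a, 'b) monoid_scheme \<Rightarrow> 'a set" where
  "loop_center Q = {z \<in> carrier Q.
     (\<forall>x\<in>carrier Q. z \<otimes>\<^bsub>Q\<^esub> x = x \<otimes>\<^bsub>Q\<^esub> z) \<and>
     (\<forall>x\<in>carrier Q. \<forall>y\<in>carrier Q.
        (z \<otimes>\<^bsub>Q\<^esub> x) \<otimes>\<^bsub>Q\<^esub> y = z \<otimes>\<^bsub>Q\<^esub> (x \<otimes>\<^bsub>Q\<^esub> y) \<and>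
        (x \<otimes>\<^bsub>Q\<^esub> z) \<otimes>\<^bsub>Q\<^esub> y = x \<otimes>\<^bsub>Q\<^esub> (z \<otimes>\<^bsub>Q\<^esub> y) \<and>
        (x \<otimes>\<^bsub>Q\<^esub> y) \<otimes>\<^bsub>Q\<^esub> z = x \<otimes>\<^bsub>Q\<^esub> (y \<otimes>\<^bsub>Q\<^esub> z))}"

text \<open>Translations are made extensional, because \<^const>\<open>BijGroup\<close> consists of
  the extensional bijections of the given set.\<close>

definition left_translation :: "('a, 'b) monoid_scheme \<Rightarrow> 'a \<Rightarrow> 'a \<Rightarrow> 'a" where
  "left_translation Q x = (\<lambda>y\<in>carrier Q. x \<otimes>\<^bsub>Q\<^esub> y)"

definition right_translation :: "('a, 'b) monoid_scheme \<Rightarrow> 'a \<Rightarrow> 'a \<Rightarrow> 'a" where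
  "right_translation Q x = (\<lambda>y\<in>carrier Q. y \<otimes>\<^bsub>Q\<^esub> x)"

definition Mlt :: "('a, 'b) monoid_scheme \<Rightarrow> ('a \<Rightarrow> 'a) monoid" where
  "Mlt Q = (BijGroup (carrier Q))
     \<lparr>carrier := generate (BijGroup (carrier Q))
        (left_translation Q ` carrier Q \<union> right_translation Q ` carrier Q)\<rparr>"

text \<open>The locale \<open>simple_group\<close> of HOL-Algebra demands \<open>order G > 1\<close>, which
  fails for every infinite group (there \<open>order G = 0\<close>), so simplicity is
  defined here for groups of arbitrary cardinality.\<close>

definition is_simple_group :: "('a, 'b) monoid_scheme \<Rightarrow> bool" where
  "is_simple_group G \<longleftrightarrow> group G \<and> carrier G \<noteq> {\<one>\<^bsub>G\<^esub>} \<and>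
     (\<forall>H. H \<lhd> G \<longrightarrow> H = {\<one>\<^bsub>G\<^esub>} \<or> H = carrier G)"


section \<open>Orthogonal groups\<close>

text \<open>The vector space \<open>V\<close> is a whole type, given by its scalar multiplication \<open>s\<close>.\<close>

definition orthogonal_group ::
    "('f::field \<Rightarrow> 'v::ab_group_add \<Rightarrow> 'v) \<Rightarrow> ('v \<Rightarrow> 'f) \<Rightarrow> ('v \<Rightarrow> 'v) monoid" where
  "orthogonal_group s N =
     \<lparr>carrier = {f. Vector_Spaces.linear s s f \<and> bij f \<and> (\<forall>x. N (f x) = N x)},
      mult = (\<circ>), one = id\<rparr>"

definition Omega ::
    "('f::field \<Rightarrow> 'v::ab_group_add \<Rightarrow> 'v) \<Rightarrow> ('v \<Rightarrow> 'f) \<Rightarrow> ('v \<Rightarrow> 'v) monoid" where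
  "Omega s N = (orthogonal_group s N)
     \<lparr>carrier := derived (orthogonal_group s N) (carrier (orthogonal_group s N))\<rparr>"

definition POmega ::
    "('f::field \<Rightarrow> 'v::ab_group_add \<Rightarrow> 'v) \<Rightarrow> ('v \<Rightarrow> 'f) \<Rightarrow> ('v \<Rightarrow> 'v) set monoid" where
  "POmega s N = Omega s N Mod {id, uminus}"


section \<open>The split octonions as Zorn vector matrices\<close>

definition dot :: "'a::field ^ 3 \<Rightarrow> 'a ^ 3 \<Rightarrow> 'a" where
  "dot x y = (\<Sum>i\<in>UNIV. x $ i * y $ i)"

definition cross :: "'a::field ^ 3 \<Rightarrow> 'a ^ 3 \<Rightarrow> 'a ^ 3" where
  "cross x y = vector [x $ 2 * y $ 3 - x $ 3 * y $ 2,
                       x $ 3 * y $ 1 - x $ 1 * y $ 3,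
                       x $ 1 * y $ 2 - x $ 2 * y $ 1]"

text \<open>\<open>Zorn a \<alpha> \<beta> b\<close> is the matrix with first row \<open>a, \<alpha>\<close> and second row \<open>\<beta>, b\<close>.\<close>

datatype 'a zorn = Zorn 'a "'a ^ 3" "'a ^ 3" 'a

instantiation zorn :: (field) "{ab_group_add, one, times}"
begin

definition zero_zorn :: "'a zorn" where
  "zero_zorn = Zorn 0 0 0 0"

definition one_zorn :: "'a zorn" where
  "one_zorn = Zorn 1 0 0 1"

fun plus_zorn :: "'a zorn \<Rightarrow> 'a zorn \<Rightarrow> 'a zorn" where
  "Zorn a \<alpha> \<beta> b + Zorn c \<gamma> \<delta> d = Zorn (a + c) (\<alpha> + \<gamma>) (\<beta> + \<delta>) (b + d)"

fun minus_zorn :: "'a zorn \<Rightarrow> 'a zorn \<Rightarrow> 'a zorn" where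
  "Zorn a \<alpha> \<beta> b - Zorn c \<gamma> \<delta> d = Zorn (a - c) (\<alpha> - \<gamma>) (\<beta> - \<delta>) (b - d)"

fun uminus_zorn :: "'a zorn \<Rightarrow> 'a zorn" where
  "- Zorn a \<alpha> \<beta> b = Zorn (- a) (- \<alpha>) (- \<beta>) (- b)"

fun times_zorn :: "'a zorn \<Rightarrow> 'a zorn \<Rightarrow> 'a zorn" where
  "Zorn a \<alpha> \<beta> b * Zorn c \<gamma> \<delta> d =
     Zorn (a * c + dot \<alpha> \<delta>) (a *s \<gamma> + d *s \<alpha> - cross \<beta> \<delta>)
          (c *s \<beta> + b *s \<delta> + cross \<alpha> \<gamma>) (dot \<beta> \<gamma> + b * d)"

instance
proof
  fix x y z :: "'a zorn"
  show "x + y + z = x + (y + z)"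
    by (cases x; cases y; cases z) (simp add: add.assoc)
  show "x + y = y + x"
    by (cases x; cases y) (simp add: add.commute)
  show "0 + x = x"
    by (cases x) (simp add: zero_zorn_def)
  show "- x + x = 0"
    by (cases x) (simp add: zero_zorn_def)
  show "x - y = x + - y"
    by (cases x; cases y) simp
qed

end

fun zorn_scale :: "'a::field \<Rightarrow> 'a zorn \<Rightarrow> 'a zorn" where
  "zorn_scale t (Zorn a \<alpha> \<beta> b) = Zorn (t * a) (t *s \<alpha>) (t *s \<beta>) (t * b)"

fun zorn_norm :: "'a::field zorn \<Rightarrow> 'a" where
  "zorn_norm (Zorn a \<alpha> \<beta> b) = a * b - dot \<alpha> \<beta>"

lemma vector_space_zorn: "vector_space (zorn_scale :: 'a::field \<Rightarrow> 'a zorn \<Rightarrow> 'a zorn)"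
proof
  fix s t :: 'a and x y :: "'a zorn"
  show "zorn_scale s (x + y) = zorn_scale s x + zorn_scale s y"
    by (cases x; cases y) (simp add: algebra_simps vector_add_ldistrib)
  show "zorn_scale (s + t) x = zorn_scale s x + zorn_scale t x"
    by (cases x) (simp add: algebra_simps vector_sadd_rdistrib)
  show "zorn_scale s (zorn_scale t x) = zorn_scale (s * t) x"
    by (cases x) (simp add: algebra_simps vector_smult_assoc)
  show "zorn_scale 1 x = x"
    by (cases x) simp
qed

lemma zorn_norm_mult: "zorn_norm (x * y) = zorn_norm x * zorn_norm y"
  by (cases x; cases y) (simp add: dot_def cross_def sum_3 algebra_simps)


section \<open>The Paige loop\<close>

definition Moufang_M :: "'a::field zorn monoid" where
  "Moufang_M = \<lparr>carrier = {x. zorn_norm x = 1}, mult = (*), one = 1\<rparr>"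

definition Paige_loop :: "'a::field zorn set monoid" where
  "Paige_loop = Moufang_M Mod loop_center Moufang_M"

lemma loop_center_Moufang_M: "loop_center (Moufang_M :: 'a::field zorn monoid) = {1, - 1}"
proof
  show "loop_center (Moufang_M :: 'a zorn monoid) \<subseteq> {1, - 1}"
  proof
    fix z :: "'a zorn"
    assume z: "z \<in> loop_center Moufang_M"
    obtain a A B b where zz: "z = Zorn a A B b"
      by (cases z)
    have n: "a * b - dot A B = 1"
      using z by (simp add: loop_center_def Moufang_M_def zz)
    have comm: "z * x = x * z" if "zorn_norm x = 1" for x
      using z that by (simp add: loop_center_def Moufang_M_def)
    have 1: "dot v B = 0 \<and> a *s v = b *s v" for v
      using comm[of "Zorn 1 v 0 1"]
      by (simp add: zz dot_def cross_def sum_3 vec_eq_iff forall_3)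
    have 2: "dot A v = 0" for v
      using comm[of "Zorn 1 0 v 1"]
      by (simp add: zz dot_def cross_def sum_3 vec_eq_iff forall_3)
    have "B $ i = 0" "a = b" "A $ i = 0" for i
      using 1[of "axis i 1"] 2[of "axis i 1"]
      by (auto simp: dot_def axis_def vec_eq_iff if_distrib if_distribR cong: if_cong)
    then have "A = 0" "B = 0" "a = b"
      by (auto simp: vec_eq_iff)
    moreover from this have "a = 1 \<or> a = - 1"
      using n by (simp add: dot_def square_eq_1_iff)
    ultimately show "z \<in> {1, - 1}"
      by (auto simp: zz one_zorn_def)
  qed
  show "{1, - 1} \<subseteq> loop_center (Moufang_M :: 'a zorn monoid)"
  proof -
    have l: "1 * x = x" "x * 1 = x" "(- 1) * x = - x" "x * (- 1) = - x" for x :: "'a zorn"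
      by (cases x; simp add: one_zorn_def dot_def cross_def sum_3 vec_eq_iff forall_3)+
    have m: "(- x) * y = - (x * y)" "x * (- y) = - (x * y)" for x y :: "'a zorn"
      by (cases x; cases y; simp add: dot_def cross_def sum_3 vec_eq_iff forall_3 algebra_simps)+
    have "zorn_norm (1 :: 'a zorn) = 1" "zorn_norm (- 1 :: 'a zorn) = 1"
      by (simp_all add: one_zorn_def dot_def)
    then show ?thesis
      by (auto simp: loop_center_def Moufang_M_def l m)
  qed
qed

end

theory Submission
  imports Defs
begin

text \<open>
  Let \<open>O\<close> be the orthogonal group of the norm \<open>N\<close> on the split octonions, let \<open>T\<close> be its
  subgroup generated by the Siegel transformations
  \<open>v \<mapsto> v + B v u \<odot> w - B v w \<odot> u - (N w * B v u) \<odot> u\<close> (\<open>u\<close> singular, \<open>w\<close> orthogonal to \<open>u\<close>), and let \<open>G\<close> be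
  generated by the left and right multiplications \<open>L x\<close>, \<open>R x\<close> by elements of norm 1.  The
  heart of the matter is that \<open>G\<close>, \<open>T\<close> and the commutator subgroup of \<open>O\<close> coincide, and that \<open>T\<close> is simple modulo
  scalars.  All fields are treated alike, including those with two or three elements.

  The statements on \<open>T\<close> use nothing but a basis of at least three orthogonal hyperbolic planes.
  Transitivity of \<open>T\<close> on singular vectors, relative to planes that are to stay fixed, reduces an isometry
  modulo \<open>T\<close> to an isometry of a single plane of one's choice.  As isometries of different
  planes commute, \<open>O\<close> modulo \<open>T\<close> is abelian; and \<open>T\<close> is generated by commutators of
  Siegel transformations.  This gives \<open>derived_eq_siegel_group\<close>.  Simplicity is \<open>siegel_group_minimal\<close>:
  a subgroup of \<open>O\<close> that is normalised by \<open>T\<close> and has a nonscalar element contains \<open>T\<close>.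

  For \<open>G \<subseteq> T\<close>, the multiplication \<open>L x\<close> by a unitriangular \<open>x\<close> is a product of two explicit Siegel
  transformations.  Elements of norm 1 reduce to unitriangular ones by row operations, and the Moufang
  identity transports membership in \<open>T\<close>.  For \<open>T \<subseteq> G\<close>, note that \<open>R a \<circ> L a\<close> is the product
  of the reflections in \<open>a\<close> and in 1.  So \<open>G\<close> contains all products of two reflections in
  vectors of norm 1; these generate a normal subgroup of \<open>O\<close>, and \<open>siegel_group_minimal\<close> applies to it.

  Finally, \<open>T = G\<close> acts on the cosets \<open>{x, - x}\<close>, which are the elements of the Paige loop; \<open>L x\<close> and \<open>R x\<close> act as
  the translations by the coset of \<open>x\<close>.  So the multiplication group of the Paige loop is the image of \<open>T\<close>.  The kernel
  consists of \<open>id\<close> and \<open>uminus\<close>, because an isometry that preserves every element of norm 1 up to sign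
  is \<open>id\<close> or \<open>uminus\<close>.
\<close>

section \<open>Siegel transformations of a hyperbolic space\<close>

definition polar :: "('v::ab_group_add \<Rightarrow> 'f::field) \<Rightarrow> 'v \<Rightarrow> 'v \<Rightarrow> 'f" where
  "polar N x y = N (x + y) - N x - N y"

text \<open>The space is given by a hyperbolic basis: \<open>n\<close> mutually orthogonal pairs \<open>e i\<close>, \<open>f i\<close> of singular
  vectors with polar product 1.  The axiom \<open>expand\<close> says at the same time that the basis spans and
  that the polar form is nondegenerate.  Everything is stated by means of \<open>N\<close> and its polar form,
  without halving, so characteristic 2 is covered.  At least three pairs
  are required because the commutator calculations and the detours below need a plane besides two given ones.\<close>

locale hyperbolic_space = vector_space scale
  for scale :: "'f::field \<Rightarrow> 'v::ab_group_add \<Rightarrow> 'v" (infixr "\<odot>" 75) +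
  fixes N :: "'v \<Rightarrow> 'f" and e f :: "nat \<Rightarrow> 'v" and n :: nat
  assumes N_scale: "N (c \<odot> x) = c ^ 2 * N x"
    and polar_add_left: "polar N (x + y) z = polar N x z + polar N y z"
    and polar_scale_left: "polar N (c \<odot> x) z = c * polar N x z"
    and singular_e: "i < n \<Longrightarrow> N (e i) = 0"
    and singular_f: "i < n \<Longrightarrow> N (f i) = 0"
    and polar_e_f: "i < n \<Longrightarrow> j < n \<Longrightarrow> polar N (e i) (f j) = (if i = j then 1 else 0)"
    and polar_e_e: "i < n \<Longrightarrow> j < n \<Longrightarrow> polar N (e i) (e j) = 0"
    and polar_f_f: "i < n \<Longrightarrow> j < n \<Longrightarrow> polar N (f i) (f j) = 0"
    and expand: "v = (\<Sum>i<n. polar N v (f i) \<odot> e i + polar N v (e i) \<odot> f i)"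
    and three_le_n: "3 \<le> n"
begin

abbreviation B :: "'v \<Rightarrow> 'v \<Rightarrow> 'f" where
  "B \<equiv> polar N"

abbreviation OG :: "('v \<Rightarrow> 'v) monoid" where
  "OG \<equiv> orthogonal_group scale N"

lemma polar_commute: "B x y = B y x"
  by (simp add: polar_def algebra_simps)

lemma polar_add_right: "B z (x + y) = B z x + B z y"
  by (metis polar_add_left polar_commute)

lemma polar_scale_right: "B z (c \<odot> x) = c * B z x"
  by (metis polar_scale_left polar_commute)

lemma polar_minus_left: "B (- x) z = - B x z"
  using polar_scale_left[of "-1" x z] by simp

lemma polar_minus_right: "B z (- x) = - B z x"
  using polar_scale_right[of z "-1" x] by simp

lemma polar_diff_left: "B (x - y) z = B x z - B y z"
  using polar_add_left[of x "- y" z] by (simp add: polar_minus_left)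

lemma polar_diff_right: "B z (x - y) = B z x - B z y"
  using polar_add_right[of z x "- y"] by (simp add: polar_minus_right)

lemma polar_zero_left: "B 0 z = 0"
  using polar_scale_left[of 0 0 z] by simp

lemma polar_zero_right: "B z 0 = 0"
  using polar_scale_right[of z 0 0] by simp

lemmas polar_simps = polar_add_left polar_scale_left polar_add_right polar_scale_right
  polar_minus_left polar_minus_right polar_diff_left polar_diff_right
  polar_zero_left polar_zero_right

lemma N_zero: "N 0 = 0"
  using N_scale[of 0 0] by simp

lemma N_minus: "N (- x) = N x"
  using N_scale[of "-1" x] by simp

lemma N_add: "N (x + y) = N x + N y + B x y"
  by (simp add: polar_def)

lemma N_diff: "N (x - y) = N x + N y - B x y"
  using N_add[of x "- y"] by (simp add: N_minus polar_minus_right)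

lemma polar_self: "B x x = 2 * N x"
proof -
  have "x + x = 2 \<odot> x"
    using scale_left_distrib[of 1 1 x] by simp
  then show ?thesis
    by (simp add: polar_def N_scale power2_eq_square)
qed

lemmas N_simps = N_add N_diff N_scale N_minus N_zero

text \<open>This turns identities between vectors into identities in the field.\<close>

lemma vector_eqI:
  assumes "\<And>z. B v z = B w z"
  shows "v = w"
  using assms expand[of v] expand[of w] by simp

lemma basis_polar:
  assumes "i < n" "j < n"
  shows "B (e i) (f j) = (if i = j then 1 else 0)" "B (f j) (e i) = (if i = j then 1 else 0)"
    "B (e i) (e j) = 0" "B (f i) (f j) = 0"
  using assms by (auto simp: polar_e_f polar_e_e polar_f_f polar_commute[of "f j" "e i"])

lemma carrier_OG_iff:
  "g \<in> carrier OG \<longleftrightarrow>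
     (\<forall>x y. g (x + y) = g x + g y) \<and> (\<forall>c x. g (c \<odot> x) = c \<odot> g x) \<and> bij g \<and> (\<forall>x. N (g x) = N x)"
  using vector_space_axioms
  by (auto simp: orthogonal_group_def Vector_Spaces.linear_iff)

lemma mult_OG [simp]: "g \<otimes>\<^bsub>OG\<^esub> h = g \<circ> h"
  and one_OG [simp]: "\<one>\<^bsub>OG\<^esub> = id"
  by (simp_all add: orthogonal_group_def)

lemma OG_add: "g \<in> carrier OG \<Longrightarrow> g (x + y) = g x + g y"
  and OG_scale: "g \<in> carrier OG \<Longrightarrow> g (c \<odot> x) = c \<odot> g x"
  and OG_bij: "g \<in> carrier OG \<Longrightarrow> bij g"
  and OG_norm: "g \<in> carrier OG \<Longrightarrow> N (g x) = N x"
  by (auto simp: carrier_OG_iff)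

lemma OG_polar: "g \<in> carrier OG \<Longrightarrow> B (g x) (g y) = B x y"
  by (simp add: polar_def OG_norm flip: OG_add)

lemma OG_zero: "g \<in> carrier OG \<Longrightarrow> g 0 = 0"
  using OG_scale[of g 0 0] by simp

lemma OG_minus: "g \<in> carrier OG \<Longrightarrow> g (- x) = - g x"
  using OG_scale[of g "-1" x] by simp

lemma OG_diff: "g \<in> carrier OG \<Longrightarrow> g (x - y) = g x - g y"
  using OG_add[of g x "- y"] by (simp add: OG_minus)

lemma OG_sum: "g \<in> carrier OG \<Longrightarrow> g (sum h A) = (\<Sum>a\<in>A. g (h a))"
  by (induction A rule: infinite_finite_induct) (simp_all add: OG_zero OG_add)

lemma group_OG: "group OG"
proof (rule groupI)
  show "x \<otimes>\<^bsub>OG\<^esub> y \<in> carrier OG" if "x \<in> carrier OG" "y \<in> carrier OG" for x y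
    using that by (auto simp: carrier_OG_iff bij_comp)
  show "\<one>\<^bsub>OG\<^esub> \<in> carrier OG"
    by (simp add: carrier_OG_iff)
  show "\<exists>y\<in>carrier OG. y \<otimes>\<^bsub>OG\<^esub> x = \<one>\<^bsub>OG\<^esub>" if x: "x \<in> carrier OG" for x
  proof
    let ?y = "inv_into UNIV x"
    have b: "bij x"
      using x by (rule OG_bij)
    have c: "x (?y u) = u" "?y (x u) = u" for u
      using b by (simp_all add: bij_is_surj surj_f_inv_f bij_is_inj inv_f_f)
    show "?y \<in> carrier OG"
      unfolding carrier_OG_iff
    proof (intro conjI allI)
      show "?y (u + v) = ?y u + ?y v" for u v
        by (metis c OG_add[OF x])
      show "?y (a \<odot> u) = a \<odot> ?y u" for a u
        by (metis c OG_scale[OF x])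
      show "bij ?y"
        using b by (rule bij_imp_bij_inv)
      show "N (?y u) = N u" for u
        by (metis c OG_norm[OF x])
    qed
    show "?y \<otimes>\<^bsub>OG\<^esub> x = \<one>\<^bsub>OG\<^esub>"
      using c by auto
  qed
qed (auto simp: comp_assoc)

sublocale OG: group OG
  by (rule group_OG)

lemma OG_inv_apply [simp]:
  assumes "g \<in> carrier OG"
  shows "g ((inv\<^bsub>OG\<^esub> g) x) = x" "(inv\<^bsub>OG\<^esub> g) (g x) = x"
  using OG.r_inv[OF assms] OG.l_inv[OF assms] by (simp_all add: fun_eq_iff)

lemma OG_comp: "g \<in> carrier OG \<Longrightarrow> h \<in> carrier OG \<Longrightarrow> g \<circ> h \<in> carrier OG"
  using OG.m_closed by simp

lemma OG_ext:
  assumes "g \<in> carrier OG" "h \<in> carrier OG"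
    and "\<And>i. i < n \<Longrightarrow> g (e i) = h (e i)" "\<And>i. i < n \<Longrightarrow> g (f i) = h (f i)"
  shows "g = h"
proof
  fix v
  show "g v = h v"
    by (subst (1 2) expand[of v]) (simp add: assms OG_sum OG_add OG_scale)
qed

text \<open>The Siegel (or Eichler) transformation of a singular vector \<open>u\<close> and a vector \<open>w\<close>
  orthogonal to \<open>u\<close>; for fixed \<open>u\<close> these form an abelian group of isometries fixing \<open>u\<close>.\<close>

definition siegel :: "'v \<Rightarrow> 'v \<Rightarrow> 'v \<Rightarrow> 'v" where
  "siegel u w v = v + B v u \<odot> w - B v w \<odot> u - (N w * B v u) \<odot> u"

lemma siegel_zero: "siegel u 0 = id"
  by (auto simp: siegel_def polar_simps N_zero)

lemma siegel_add:
  assumes "N u = 0" "B u w = 0" "B u w' = 0"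
  shows "siegel u w \<circ> siegel u w' = siegel u (w + w')"
proof
  fix v
  have s: "B w u = 0" "B w' u = 0" "B u u = 0"
    using assms by (simp_all add: polar_commute[of _ u] polar_self)
  show "(siegel u w \<circ> siegel u w') v = siegel u (w + w') v"
    by (rule vector_eqI)
      (simp add: siegel_def polar_simps s assms N_simps polar_commute[of w' w] algebra_simps)
qed

lemma siegel_in_OG:
  assumes "N u = 0" "B u w = 0"
  shows "siegel u w \<in> carrier OG"
  unfolding carrier_OG_iff
proof (intro conjI allI)
  have s: "B w u = 0" "B u u = 0"
    using assms by (simp_all add: polar_commute[of _ u] polar_self)
  show "siegel u w (x + y) = siegel u w x + siegel u w y" for x y
    by (rule vector_eqI) (simp add: siegel_def polar_simps algebra_simps)
  show "siegel u w (c \<odot> x) = c \<odot> siegel u w x" for c x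
    by (rule vector_eqI) (simp add: siegel_def polar_simps algebra_simps)
  have "siegel u w \<circ> siegel u (- w) = id" "siegel u (- w) \<circ> siegel u w = id"
    using assms by (simp_all add: siegel_add polar_simps siegel_zero)
  then show "bij (siegel u w)"
    using o_bij by blast
  show "N (siegel u w x) = N x" for x
    using assms s
    by (simp add: siegel_def N_simps polar_simps power2_eq_square algebra_simps)
qed

lemma inv_siegel:
  assumes "N u = 0" "B u w = 0"
  shows "inv\<^bsub>OG\<^esub> (siegel u w) = siegel u (- w)"
  using assms
  by (intro OG.inv_equality) (simp_all add: siegel_in_OG siegel_add polar_simps siegel_zero)

lemma siegel_conj:
  assumes g: "g \<in> carrier OG"
  shows "g \<circ> siegel u w \<circ> inv\<^bsub>OG\<^esub> g = siegel (g u) (g w)"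
proof
  fix v
  have "B ((inv\<^bsub>OG\<^esub> g) v) x = B v (g x)" for x
    using OG_polar[OF g, of "(inv\<^bsub>OG\<^esub> g) v" x] g by simp
  then show "(g \<circ> siegel u w \<circ> inv\<^bsub>OG\<^esub> g) v = siegel (g u) (g w) v"
    using g by (simp add: siegel_def OG_add OG_diff OG_scale OG_norm)
qed

lemma siegel_scale: "siegel (c \<odot> u) w = siegel u (c \<odot> w)"
proof
  fix v
  show "siegel (c \<odot> u) w v = siegel u (c \<odot> w) v"
    by (simp add: siegel_def polar_simps N_scale mult_ac power2_eq_square)
qed

lemma siegel_self: "N u = 0 \<Longrightarrow> siegel u (c \<odot> u) = id"
  by (auto simp: siegel_def polar_simps N_scale mult_ac)

text \<open>If the singular vectors \<open>p\<close> and \<open>q\<close> have the same nonzero product with the singular vector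
  \<open>r\<close>, then the Siegel transformations of \<open>r\<close> already carry \<open>p\<close> to \<open>q\<close>.  All transitivity statements
  are built from this one.\<close>

lemma siegel_moves:
  assumes "N p = 0" "N q = 0" "N r = 0" "B p r = B q r" "B p r \<noteq> 0"
  shows "siegel r (inverse (B p r) \<odot> (q - p)) p = q" "B r (inverse (B p r) \<odot> (q - p)) = 0"
proof -
  let ?c = "B p r"
  have s: "B r q = ?c" "B r p = ?c" "B q r = ?c"
    using assms(4) by (simp_all add: polar_commute[of r])
  show "B r (inverse ?c \<odot> (q - p)) = 0"
    by (simp add: polar_simps s)
  show "siegel r (inverse ?c \<odot> (q - p)) p = q"
    using assms(1,2,5)
    by (simp add: siegel_def polar_simps N_simps s polar_self polar_commute[of q p]
        power2_eq_square mult.assoc)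
qed

end

text \<open>Modulo \<open>H\<close> the two factors of the commutator are \<open>x\<close> and \<open>y\<close>, which commute.\<close>

lemma (in group) commutator_in_normal:
  assumes "H \<lhd> G" "a \<in> H" "b \<in> H" "x \<in> carrier G" "y \<in> carrier G" "x \<otimes> y = y \<otimes> x"
  shows "(a \<otimes> x) \<otimes> (b \<otimes> y) \<otimes> inv (a \<otimes> x) \<otimes> inv (b \<otimes> y) \<in> H"
proof -
  interpret H: normal H G
    by (rule assms(1))
  have c: "a \<in> carrier G" "b \<in> carrier G"
    using assms H.subset by auto
  have xy: "y \<otimes> inv x = inv x \<otimes> y"
    using assms(4-6) by (metis inv_closed inv_solve_left m_assoc m_closed r_inv r_one)
  have "(a \<otimes> x) \<otimes> (b \<otimes> y) \<otimes> inv (a \<otimes> x) \<otimes> inv (b \<otimes> y)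
      = a \<otimes> x \<otimes> b \<otimes> (y \<otimes> inv x) \<otimes> inv a \<otimes> inv y \<otimes> inv b"
    using c assms(4,5) by (simp add: inv_mult_group m_assoc)
  also have "\<dots> = a \<otimes> (x \<otimes> b \<otimes> inv x) \<otimes> (y \<otimes> inv a \<otimes> inv y) \<otimes> inv b"
    unfolding xy using c assms(4,5) by (simp add: m_assoc)
  also have "\<dots> \<in> H"
    using assms by (intro H.m_closed H.inv_op_closed2 H.m_inv_closed) auto
  finally show ?thesis .
qed

context hyperbolic_space
begin

definition siegel_group :: "('v \<Rightarrow> 'v) set" where
  "siegel_group = generate OG {siegel u w |u w. N u = 0 \<and> B u w = 0}"

lemma siegel_group_normal: "siegel_group \<lhd> OG"
  unfolding siegel_group_def
proof (rule OG.normal_generateI)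
  show "{siegel u w |u w. N u = 0 \<and> B u w = 0} \<subseteq> carrier OG"
    using siegel_in_OG by auto
  fix h g
  assume "h \<in> {siegel u w |u w. N u = 0 \<and> B u w = 0}" and g: "g \<in> carrier OG"
  then obtain u w where h: "h = siegel u w" "N u = 0" "B u w = 0"
    by auto
  then have "N (g u) = 0" "B (g u) (g w) = 0"
    using g by (simp_all add: OG_norm OG_polar)
  then show "g \<otimes>\<^bsub>OG\<^esub> h \<otimes>\<^bsub>OG\<^esub> inv\<^bsub>OG\<^esub> g \<in> {siegel u w |u w. N u = 0 \<and> B u w = 0}"
    using siegel_conj[OF g, of u w] h by auto
qed

sublocale SG: normal siegel_group OG
  by (rule siegel_group_normal)

lemma siegel_in_siegel_group: "N u = 0 \<Longrightarrow> B u w = 0 \<Longrightarrow> siegel u w \<in> siegel_group"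
  unfolding siegel_group_def by (rule generate.incl) auto

lemma siegel_group_in_OG: "t \<in> siegel_group \<Longrightarrow> t \<in> carrier OG"
  using SG.subset by auto

lemma siegel_group_comp: "s \<in> siegel_group \<Longrightarrow> t \<in> siegel_group \<Longrightarrow> s \<circ> t \<in> siegel_group"
  using SG.m_closed by simp

section \<open>Transitivity on singular vectors\<close>

definition basis_perp :: "nat set \<Rightarrow> 'v set" where
  "basis_perp I = {v. \<forall>i\<in>I. B v (e i) = 0 \<and> B v (f i) = 0}"

text \<open>\<open>link I p q\<close> says that one Siegel transformation, taken inside the orthogonal complement
  of the planes with index in \<open>I\<close> and hence fixing those planes, carries \<open>p\<close> to \<open>q\<close>.  Chains of links,
  rather than just the group elements that they yield, are needed twice: once for
  transitivity, and once to spread orbits of a normal subgroup in \<open>siegel_group_minimal\<close>.\<close>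

definition link :: "nat set \<Rightarrow> 'v \<Rightarrow> 'v \<Rightarrow> bool" where
  "link I p q \<longleftrightarrow> p \<in> basis_perp I \<and> q \<in> basis_perp I \<and> N p = 0 \<and> N q = 0 \<and>
     (\<exists>r\<in>basis_perp I. N r = 0 \<and> B p r = B q r \<and> B p r \<noteq> 0)"

lemma basis_perp_diff: "v \<in> basis_perp I \<Longrightarrow> w \<in> basis_perp I \<Longrightarrow> v - w \<in> basis_perp I"
  and basis_perp_scale: "v \<in> basis_perp I \<Longrightarrow> c \<odot> v \<in> basis_perp I"
  by (auto simp: basis_perp_def polar_simps)

lemma siegel_fixes_basis:
  assumes "u \<in> basis_perp I" "w \<in> basis_perp I" "i \<in> I"
  shows "siegel u w (e i) = e i" "siegel u w (f i) = f i"
  using assms by (auto simp: siegel_def basis_perp_def polar_commute[of _ u] polar_commute[of _ w])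

lemma link_chain_siegel_group:
  assumes "(link I)\<^sup>*\<^sup>* p q"
  shows "\<exists>t\<in>siegel_group. t p = q \<and> (\<forall>i\<in>I. t (e i) = e i \<and> t (f i) = f i)"
  using assms
proof induction
  case base
  show ?case
    using SG.one_closed by (intro bexI[of _ id]) auto
next
  case (step q s)
  from step.IH obtain t where t: "t \<in> siegel_group" "t p = q"
    "\<forall>i\<in>I. t (e i) = e i \<and> t (f i) = f i"
    by blast
  from step.hyps(2) obtain r where r: "q \<in> basis_perp I" "s \<in> basis_perp I" "N q = 0" "N s = 0"
    "r \<in> basis_perp I" "N r = 0" "B q r = B s r" "B q r \<noteq> 0"
    by (auto simp: link_def)
  define w where "w = inverse (B q r) \<odot> (s - q)"
  have "siegel r w q = s" "B r w = 0"
    using siegel_moves[of q s r] r by (simp_all add: w_def)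
  moreover have "w \<in> basis_perp I"
    using r by (simp add: w_def basis_perp_diff basis_perp_scale)
  ultimately show ?case
    using t r
    by (intro bexI[of _ "siegel r w \<circ> t"])
      (auto simp: siegel_fixes_basis siegel_group_comp siegel_in_siegel_group)
qed

lemma nonzero_polar_basis:
  assumes "v \<noteq> 0"
  obtains j where "j < n" "B v (e j) \<noteq> 0 \<or> B v (f j) \<noteq> 0"
proof -
  have "\<exists>j<n. B v (e j) \<noteq> 0 \<or> B v (f j) \<noteq> 0"
  proof (rule ccontr)
    assume "\<not> ?thesis"
    then have "v = 0"
      by (subst expand) simp
    with assms show False ..
  qed
  then show ?thesis
    using that by blast
qed

text \<open>Some basis vector \<open>x\<close> has nonzero product with \<open>p\<close>, and it links \<open>p\<close> to a multiple of the
  partner of \<open>x\<close>.  From there to \<open>e k\<close> is one more link if the plane of \<open>x\<close> is not the \<open>k\<close>-th one;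
  otherwise a detour through \<open>e m\<close> is taken, because a link within a single plane leaves the vector unchanged.\<close>

lemma link_chain:
  assumes p: "p \<in> basis_perp I" "N p = 0" "p \<noteq> 0"
    and km: "k < n" "m < n" "k \<noteq> m" "k \<notin> I" "m \<notin> I" and I: "I \<subseteq> {..<n}"
  shows "(link I)\<^sup>*\<^sup>* p (e k)"
proof -
  have bp: "e j \<in> basis_perp I" "f j \<in> basis_perp I" if "j < n" "j \<notin> I" for j
    using that I by (auto simp: basis_perp_def basis_polar)
  have bp_add: "v + c \<odot> w \<in> basis_perp I" if "v \<in> basis_perp I" "w \<in> basis_perp I" for v w c
    using that by (auto simp: basis_perp_def polar_simps)
  have claim: "link I (c \<odot> y) (e l)"
    if "j < n" "j \<notin> I" "l < n" "l \<notin> I" "j \<noteq> l" "c \<noteq> 0" "(x, y) \<in> {(e j, f j), (f j, e j)}" for c x y j l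
    unfolding link_def
    using that bp
    \<comment> \<open>the witness has product \<open>c\<close> with both \<open>c \<odot> y\<close> and \<open>e l\<close>\<close>
    by (intro conjI bexI[of _ "x + c \<odot> f l"])
      (auto simp: bp_add basis_perp_scale N_simps polar_simps basis_polar singular_e singular_f)
  obtain j where j: "j < n" "B p (e j) \<noteq> 0 \<or> B p (f j) \<noteq> 0"
    using nonzero_polar_basis[OF p(3)] .
  then have jI: "j \<notin> I"
    using p(1) by (auto simp: basis_perp_def)
  obtain x y where xy: "(x, y) \<in> {(e j, f j), (f j, e j)}" "B p x \<noteq> 0"
    using j by blast
  have "link I p (B p x \<odot> y)"
    unfolding link_def
    using xy p bp[OF j(1) jI] j(1)
    by (intro conjI bexI[of _ x])
      (auto simp: basis_perp_scale N_simps polar_simps basis_polar singular_e singular_f)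
  moreover have "(link I)\<^sup>*\<^sup>* (B p x \<odot> y) (e k)"
  proof (cases "j = k")
    case False
    with claim[of j k "B p x" x y] j(1) jI km xy show ?thesis
      by auto
  next
    case True
    have "link I (B p x \<odot> y) (e m)"
      using claim[of j m "B p x" x y] j(1) jI km xy True by auto
    moreover have "link I (e m) (e k)"
      using claim[of m k 1 "f m" "e m"] km by auto
    ultimately show ?thesis
      by (meson converse_rtranclp_into_rtranclp r_into_rtranclp)
  qed
  ultimately show ?thesis
    by (meson converse_rtranclp_into_rtranclp)
qed

lemma basis_perp_empty [simp]: "basis_perp {} = UNIV"
  by (simp add: basis_perp_def)

lemma link_chain_e0: "N p = 0 \<Longrightarrow> p \<noteq> 0 \<Longrightarrow> (link {})\<^sup>*\<^sup>* p (e 0)"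
  using link_chain[of p "{}" 0 1] three_le_n by auto

lemma siegel_group_to_e0:
  assumes "N p = 0" "p \<noteq> 0"
  obtains t where "t \<in> siegel_group" "t p = e 0"
  using link_chain_siegel_group[OF link_chain_e0[OF assms]] by blast

section \<open>The commutator subgroup is generated by Siegel transformations\<close>

text \<open>Witt's theorem in the form needed: one hyperbolic plane after the other is brought back to
  its place, first \<open>e k\<close> along a chain of links and then \<open>f k\<close> by a Siegel transformation of \<open>e k\<close>.
  Both happen inside the complement of the planes already fixed.  This works as long as one further
  plane \<open>m\<close> remains, so the last plane cannot be treated.\<close>

lemma siegel_group_reduce:
  assumes "finite I" "I \<subset> {..<n}" "g \<in> carrier OG"
  shows "\<exists>t\<in>siegel_group. \<forall>i\<in>I. t (g (e i)) = e i \<and> t (g (f i)) = f i"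
  using assms(1,2)
proof induction
  case empty
  show ?case
    using SG.one_closed by auto
next
  case (insert k I)
  then obtain t where t: "t \<in> siegel_group" "\<forall>i\<in>I. t (g (e i)) = e i \<and> t (g (f i)) = f i"
    by auto
  obtain m where m: "m < n" "m \<notin> insert k I"
    using insert.prems by auto
  have k: "k < n" "k \<notin> I" and I: "I \<subseteq> {..<n}"
    using insert by auto
  define h where "h = t \<circ> g"
  have h: "h \<in> carrier OG"
    unfolding h_def using t assms(3) siegel_group_in_OG OG_comp by blast
  have hI: "h (e i) = e i" "h (f i) = f i" if "i \<in> I" for i
    using t that by (auto simp: h_def)
  have perp: "s (h v) \<in> basis_perp I"
    if s: "s \<in> carrier OG" "\<forall>i\<in>I. s (e i) = e i \<and> s (f i) = f i" and v: "v \<in> {e k, f k}" for s v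
  proof -
    have "B (s (h v)) (e i) = 0 \<and> B (s (h v)) (f i) = 0" if i: "i \<in> I" for i
    proof -
      have "B (s (h v)) (s (h (e i))) = B v (e i)" "B (s (h v)) (s (h (f i))) = B v (f i)"
        using s h by (simp_all add: OG_polar)
      then show ?thesis
        using i s hI v k I by (auto simp: basis_polar)
    qed
    then show ?thesis
      by (simp add: basis_perp_def)
  qed
  have "h (e k) \<in> basis_perp I"
    using perp[of id "e k"] OG.one_closed by simp
  moreover have "N (h (e k)) = 0"
    using h k by (simp add: OG_norm singular_e)
  moreover have "h (e k) \<noteq> 0"
    using OG_polar[OF h, of "e k" "f k"] k by (auto simp: basis_polar polar_zero_left)
  ultimately have "(link I)\<^sup>*\<^sup>* (h (e k)) (e k)"
    using link_chain[of "h (e k)" I k m] k m I by auto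
  then obtain s where s: "s \<in> siegel_group" "s (h (e k)) = e k"
    "\<forall>i\<in>I. s (e i) = e i \<and> s (f i) = f i"
    using link_chain_siegel_group by blast
  have sO: "s \<in> carrier OG"
    using s siegel_group_in_OG by blast
  define q where "q = s (h (f k))"
  have q: "N q = 0" "B q (e k) = 1" "q \<in> basis_perp I"
    using OG_polar[OF sO, of "h (f k)" "h (e k)"] sO h s k perp[OF sO, of "f k"]
    by (auto simp: q_def OG_norm singular_f OG_polar basis_polar)
  define w where "w = f k - q"
  have w: "siegel (e k) w q = f k" "B (e k) w = 0"
    using siegel_moves[of q "f k" "e k"] q k
    by (simp_all add: w_def singular_e singular_f basis_polar)
  have "siegel (e k) w (e k) = e k"
    using w k by (simp add: siegel_def basis_polar)
  moreover have "e k \<in> basis_perp I" "w \<in> basis_perp I"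
    using k I q by (auto simp: w_def basis_perp_def basis_polar polar_simps)
  ultimately show ?case
    using s t w hI k
    by (intro bexI[of _ "siegel (e k) w \<circ> (s \<circ> t)"] ballI)
      (auto simp: q_def h_def siegel_fixes_basis siegel_group_comp siegel_in_siegel_group singular_e)
qed

text \<open>What is left over in \<open>siegel_group_reduce\<close>: the isometries of the \<open>j\<close>-th plane.\<close>

definition plane_group :: "nat \<Rightarrow> ('v \<Rightarrow> 'v) set" where
  "plane_group j = {g \<in> carrier OG. \<forall>i<n. i \<noteq> j \<longrightarrow> g (e i) = e i \<and> g (f i) = f i}"

lemma plane_group_reduce:
  assumes "g \<in> carrier OG" "j < n"
  obtains t d where "t \<in> siegel_group" "d \<in> plane_group j" "g = t \<circ> d"
proof -
  obtain t where t: "t \<in> siegel_group" "\<forall>i\<in>{..<n} - {j}. t (g (e i)) = e i \<and> t (g (f i)) = f i"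
    using siegel_group_reduce[of "{..<n} - {j}" g] assms by auto
  have tO: "t \<in> carrier OG"
    using t siegel_group_in_OG by blast
  show ?thesis
  proof
    show "inv\<^bsub>OG\<^esub> t \<in> siegel_group"
      using t by simp
    show "t \<circ> g \<in> plane_group j"
      using t assms tO by (auto simp: plane_group_def OG_comp)
    show "g = inv\<^bsub>OG\<^esub> t \<circ> (t \<circ> g)"
      using tO by (simp add: fun_eq_iff)
  qed
qed

lemma plane_group_preserves_plane:
  assumes d: "d \<in> plane_group j" and j: "j < n" and v: "v \<in> {e j, f j}"
  shows "d v = B (d v) (f j) \<odot> e j + B (d v) (e j) \<odot> f j"
proof -
  have dO: "d \<in> carrier OG"
    using d by (simp add: plane_group_def)
  have "B (d v) (e i) = 0 \<and> B (d v) (f i) = 0" if "i < n" "i \<noteq> j" for i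
  proof -
    have "B (d v) (d (e i)) = B v (e i)" "B (d v) (d (f i)) = B v (f i)"
      using dO by (simp_all add: OG_polar)
    then show ?thesis
      using d v that j by (auto simp: plane_group_def basis_polar)
  qed
  then have "(\<Sum>i\<in>{..<n} - {j}. B (d v) (f i) \<odot> e i + B (d v) (e i) \<odot> f i) = 0"
    by (intro sum.neutral) auto
  then show ?thesis
    using expand[of "d v"] sum.remove[of "{..<n}" j "\<lambda>i. B (d v) (f i) \<odot> e i + B (d v) (e i) \<odot> f i"] j
    by auto
qed

lemma plane_groups_commute:
  assumes "c \<in> plane_group j" "d \<in> plane_group k" "j < n" "k < n" "j \<noteq> k"
  shows "c \<circ> d = d \<circ> c"
proof -
  have O: "c \<in> carrier OG" "d \<in> carrier OG"
    using assms by (auto simp: plane_group_def)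
  have key: "a (b v) = b (a v)"
    if "a \<in> plane_group l" "b \<in> plane_group m" "l < n" "m < n" "l \<noteq> m" "v \<in> {e l, f l}" for a b v l m
  proof -
    have "b (e l) = e l" "b (f l) = f l" and bO: "b \<in> carrier OG"
      using that by (auto simp: plane_group_def)
    then have "b (a v) = a v"
      by (subst (1 2) plane_group_preserves_plane[of a l v])
        (use that in \<open>auto simp: OG_add OG_scale\<close>)
    then show ?thesis
      using that(6) \<open>b (e l) = e l\<close> \<open>b (f l) = f l\<close> by auto
  qed
  have *: "c (d v) = d (c v)" if "i < n" "v \<in> {e i, f i}" for i v
  proof -
    consider "i = j" | "i = k" | "i \<noteq> j" "i \<noteq> k"
      by blast
    then show ?thesis
    proof cases
      case 1
      then show ?thesis using key[of c j d k v] assms that by auto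
    next
      case 2
      then show ?thesis using key[of d k c j v] assms that by auto
    next
      case 3
      then have "c v = v" "d v = v"
        using assms that by (auto simp: plane_group_def)
      then show ?thesis by simp
    qed
  qed
  show ?thesis
    by (rule OG_ext) (use O * in \<open>auto simp: OG_comp\<close>)
qed

text \<open>Every isometry is congruent modulo the Siegel group to an isometry of a single plane, and that
  plane may be chosen freely.  Using different planes for two isometries, one obtains commuting
  representatives, so the quotient by the Siegel group is abelian.  This avoids computing in the
  orthogonal group of a plane, and spinor norms and Dickson invariants altogether.\<close>

lemma derived_le_siegel_group: "derived OG (carrier OG) \<subseteq> siegel_group"
  unfolding derived_def
proof (rule OG.generate_subgroup_incl[OF _ SG.subgroup_axioms], clarsimp)
  fix g h
  assume gh: "g \<in> carrier OG" "h \<in> carrier OG"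
  obtain s c where s: "s \<in> siegel_group" "c \<in> plane_group 0" "g = s \<circ> c"
    using plane_group_reduce[of g 0] gh three_le_n by auto
  obtain t d where t: "t \<in> siegel_group" "d \<in> plane_group 1" "h = t \<circ> d"
    using plane_group_reduce[of h 1] gh three_le_n by auto
  have "c \<circ> d = d \<circ> c"
    using plane_groups_commute[of c 0 d 1] s t three_le_n by auto
  then show "g \<circ> h \<circ> inv\<^bsub>OG\<^esub> g \<circ> inv\<^bsub>OG\<^esub> h \<in> siegel_group"
    using OG.commutator_in_normal[OF siegel_group_normal s(1) t(1), of c d] s t
    by (simp add: plane_group_def)
qed

end

text \<open>The second entry \<open>u \<otimes> k\<close> is \<open>u\<close> modulo \<open>K\<close>, and \<open>u\<close> commutes with \<open>x\<close>.  As \<open>K\<close> need not be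
  normal in \<open>G\<close>, the conjugates that have to stay in \<open>K\<close> are listed.\<close>

lemma (in group) commutator_with_conjugate:
  assumes "subgroup K G" "x \<in> carrier G" "u \<in> carrier G" "x \<otimes> u = u \<otimes> x" "k \<in> K"
    and "x \<otimes> k \<otimes> inv x \<in> K" and conj: "\<And>z. z \<in> K \<Longrightarrow> u \<otimes> z \<otimes> inv u \<in> K"
  shows "x \<otimes> (u \<otimes> k) \<otimes> inv x \<otimes> inv (u \<otimes> k) \<in> K"
proof -
  interpret K: subgroup K G
    by (rule assms(1))
  have k: "k \<in> carrier G"
    using assms K.subset by auto
  have "x \<otimes> (u \<otimes> k) \<otimes> inv x \<otimes> inv (u \<otimes> k)
      = (x \<otimes> u) \<otimes> k \<otimes> inv x \<otimes> inv k \<otimes> inv u"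
    using k assms(2,3) by (simp add: inv_mult_group m_assoc)
  also have "\<dots> = u \<otimes> (x \<otimes> k \<otimes> inv x \<otimes> inv k) \<otimes> inv u"
    by (subst assms(4)) (use k assms(2,3) in \<open>simp add: m_assoc\<close>)
  also have "\<dots> \<in> K"
    by (rule conj[OF K.m_closed[OF assms(6) K.m_inv_closed[OF assms(5)]]])
  finally show ?thesis .
qed

context hyperbolic_space
begin

section \<open>Generation by commutators\<close>

text \<open>\<open>siegel a b\<close> fixes \<open>e 0\<close>, so conjugating by it only changes the second parameter.\<close>

lemma siegel_commutator:
  assumes "B (e 0) w = 0" "N a = 0" "B (e 0) a = 0" "B (e 0) b = 0" "B a b = 0"
  shows "siegel (e 0) w \<circ> siegel a b \<circ> inv\<^bsub>OG\<^esub> (siegel (e 0) w) \<circ> inv\<^bsub>OG\<^esub> (siegel a b)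
       = siegel (e 0) (w - siegel a b w)"
proof -
  have e: "N (e 0) = 0"
    using three_le_n by (simp add: singular_e)
  have g: "siegel a b \<in> carrier OG"
    using assms by (simp add: siegel_in_OG)
  have ge: "siegel a b (e 0) = e 0"
    using assms by (simp add: siegel_def)
  have "siegel a b \<circ> siegel (e 0) (- w) \<circ> inv\<^bsub>OG\<^esub> (siegel a b) = siegel (e 0) (- siegel a b w)"
    using siegel_conj[OF g, of "e 0" "- w"] g by (simp add: ge OG_minus)
  moreover have "B (e 0) (siegel a b w) = 0"
    using OG_polar[OF g, of "e 0" w] assms by (simp add: ge)
  ultimately show ?thesis
    using assms e by (simp add: inv_siegel comp_assoc siegel_add polar_simps)
qed

text \<open>With \<open>a = e m\<close> and \<open>w = - f m\<close> the commutator in \<open>siegel_commutator\<close> is \<open>siegel (e 0) b\<close>, for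
  \<open>b\<close> any multiple of a basis vector outside the planes 0 and \<open>m\<close>.  These generate all \<open>siegel (e 0) w\<close>
  by additivity, and \<open>e 0\<close> can be moved to any nonzero singular vector.  The lemma is applied both to the
  derived group and, for simplicity, to normal subgroups.\<close>

lemma siegel_group_le:
  assumes K: "subgroup K OG"
    and conj: "\<And>t k. t \<in> siegel_group \<Longrightarrow> k \<in> K \<Longrightarrow> t \<circ> k \<circ> inv\<^bsub>OG\<^esub> t \<in> K"
    and comm: "\<And>w a b. B (e 0) w = 0 \<Longrightarrow> N a = 0 \<Longrightarrow> B (e 0) a = 0 \<Longrightarrow> B (e 0) b = 0 \<Longrightarrow> B a b = 0 \<Longrightarrow>
      siegel (e 0) w \<circ> siegel a b \<circ> inv\<^bsub>OG\<^esub> (siegel (e 0) w) \<circ> inv\<^bsub>OG\<^esub> (siegel a b) \<in> K"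
  shows "siegel_group \<subseteq> K"
proof -
  interpret K: subgroup K OG
    by (rule K)
  have n: "0 < n"
    using three_le_n by simp
  have e0: "N (e 0) = 0" "B (e 0) (e 0) = 0"
    using n by (simp_all add: singular_e basis_polar)
  have id: "id \<in> K"
    using K.one_closed by simp
  have basis: "siegel (e 0) (c \<odot> y) \<in> K" if j: "j < n" "j \<noteq> 0" and y: "y \<in> {e j, f j}" for c y j
  proof -
    \<comment> \<open>a plane different from those of \<open>e 0\<close> and of \<open>y\<close>\<close>
    define m :: nat where "m = (if j = 1 then 2 else 1)"
    have m: "m < n" "m \<noteq> 0" "m \<noteq> j"
      using three_le_n by (auto simp: m_def)
    have "siegel (e m) (c \<odot> y) (- f m) = - f m - c \<odot> y"
      using m j y by (auto simp: siegel_def polar_simps basis_polar N_scale singular_e singular_f)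
    moreover have "siegel (e 0) (- f m) \<circ> siegel (e m) (c \<odot> y) \<circ>
        inv\<^bsub>OG\<^esub> (siegel (e 0) (- f m)) \<circ> inv\<^bsub>OG\<^esub> (siegel (e m) (c \<odot> y)) \<in> K"
      by (rule comm) (use m j y n in \<open>auto simp: polar_simps basis_polar singular_e\<close>)
    moreover have "siegel (e 0) (- f m) \<circ> siegel (e m) (c \<odot> y) \<circ>
        inv\<^bsub>OG\<^esub> (siegel (e 0) (- f m)) \<circ> inv\<^bsub>OG\<^esub> (siegel (e m) (c \<odot> y))
        = siegel (e 0) (- f m - siegel (e m) (c \<odot> y) (- f m))"
      by (rule siegel_commutator) (use m j y n in \<open>auto simp: polar_simps basis_polar singular_e\<close>)
    ultimately show ?thesis
      by simp
  qed
  define P where "P w \<longleftrightarrow> B (e 0) w = 0 \<and> siegel (e 0) w \<in> K" for w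
  have P0: "P 0"
    using id by (simp add: P_def polar_simps siegel_zero)
  have P_add: "P (v + w)" if "P v" "P w" for v w
    using that siegel_add[OF e0(1), of v w] K.m_closed[of "siegel (e 0) v" "siegel (e 0) w"]
    by (simp add: P_def polar_simps)
  have P_sum: "P (sum g A)" if "\<And>i. i \<in> A \<Longrightarrow> P (g i)" for g :: "nat \<Rightarrow> 'v" and A
    using that by (induction A rule: infinite_finite_induct) (auto simp: P0 P_add)
  have e0_in: "siegel (e 0) w \<in> K" if w: "B (e 0) w = 0" for w
  proof -
    have "P (\<Sum>i<n. B w (f i) \<odot> e i + B w (e i) \<odot> f i)"
    proof (rule P_sum)
      fix i assume "i \<in> {..<n}"
      then have i: "i < n" by simp
      show "P (B w (f i) \<odot> e i + B w (e i) \<odot> f i)"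
      proof (cases "i = 0")
        case True
        then show ?thesis
          using w e0 id by (simp add: P_def polar_commute[of w "e 0"] siegel_self polar_simps)
      next
        case False
        then have "P (c \<odot> y)" if "y \<in> {e i, f i}" for c y
          using basis[OF i False that] that i n by (auto simp: P_def polar_simps basis_polar)
        then show ?thesis
          by (intro P_add) auto
      qed
    qed
    then show ?thesis
      using expand[of w] by (simp add: P_def)
  qed
  have "siegel u w \<in> K" if u: "N u = 0" "B u w = 0" for u w
  proof (cases "u = 0")
    case True
    then have "siegel u w = id"
      by (auto simp: siegel_def polar_simps)
    then show ?thesis
      using id by simp
  next
    case False
    then obtain t where t: "t \<in> siegel_group" "t u = e 0"
      using siegel_group_to_e0 u by blast
    have tO: "t \<in> carrier OG"
      using t siegel_group_in_OG by blast
    define s where "s = inv\<^bsub>OG\<^esub> t"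
    have s: "s \<in> siegel_group" "s (e 0) = u" "s (t w) = w" "s \<in> carrier OG"
      using t(1) tO siegel_group_in_OG by (simp_all add: s_def flip: t(2))
    have "siegel (e 0) (t w) \<in> K"
      using OG_polar[OF tO, of u w] u t by (intro e0_in) simp
    then show ?thesis
      using conj[OF s(1), of "siegel (e 0) (t w)"] siegel_conj[OF s(4), of "e 0" "t w"] s(2,3) by simp
  qed
  then show ?thesis
    unfolding siegel_group_def by (intro OG.generate_subgroup_incl K) auto
qed

text \<open>For \<open>\<supseteq>\<close>, the commutators required by \<open>siegel_group_le\<close> lie in the derived group by definition.\<close>

theorem derived_eq_siegel_group: "derived OG (carrier OG) = siegel_group"
proof
  show "derived OG (carrier OG) \<subseteq> siegel_group"
    by (rule derived_le_siegel_group)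
  have d: "derived OG (carrier OG) \<lhd> OG"
    using OG.derived_self_is_normal .
  show "siegel_group \<subseteq> derived OG (carrier OG)"
  proof (rule siegel_group_le)
    show "subgroup (derived OG (carrier OG)) OG"
      using d by (rule normal_imp_subgroup)
    show "t \<circ> k \<circ> inv\<^bsub>OG\<^esub> t \<in> derived OG (carrier OG)"
      if "t \<in> siegel_group" "k \<in> derived OG (carrier OG)" for t k
      using normal.inv_op_closed2[OF d, of t k] that siegel_group_in_OG by simp
    show "siegel (e 0) w \<circ> siegel a b \<circ> inv\<^bsub>OG\<^esub> (siegel (e 0) w) \<circ> inv\<^bsub>OG\<^esub> (siegel a b)
        \<in> derived OG (carrier OG)"
      if "B (e 0) w = 0" "N a = 0" "B a b = 0" for w a b
    proof -
      have "siegel (e 0) w \<in> carrier OG" "siegel a b \<in> carrier OG"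
        using that three_le_n by (auto intro!: siegel_in_OG simp: singular_e)
      then show ?thesis
        unfolding derived_def
        by (intro generate.incl UN_I[of "siegel (e 0) w"] UN_I[of "siegel a b"]) simp_all
    qed
  qed
qed

section \<open>Simplicity\<close>

text \<open>Compare the multipliers of \<open>x\<close>, \<open>y\<close> and the singular vector \<open>x + y\<close> by pairing with the dual vectors
  \<open>x'\<close> and \<open>y'\<close>.\<close>

lemma scalar_on_singular_pair:
  assumes g: "g \<in> carrier OG" and lines: "\<And>p. N p = 0 \<Longrightarrow> \<exists>c. g p = c \<odot> p"
    and x: "N x = 0" "B x x' = 1" "B y x' = 0" and y: "N y = 0" "B y y' = 1" "B x y' = 0" "B x y = 0"
    and a: "g x = a \<odot> x"
  shows "g y = a \<odot> y"
proof -
  obtain b where b: "g y = b \<odot> y"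
    using lines y by blast
  obtain c where c: "g (x + y) = c \<odot> (x + y)"
    using lines[of "x + y"] x y by (auto simp: N_simps)
  have eq: "a \<odot> x + b \<odot> y = c \<odot> (x + y)"
    using OG_add[OF g, of x y] a b c by simp
  have "B (a \<odot> x + b \<odot> y) x' = c" "B (a \<odot> x + b \<odot> y) y' = c"
    unfolding eq using x y by (simp_all add: polar_simps)
  then show ?thesis
    using x y b by (simp add: polar_simps)
qed

text \<open>The multiplier spreads from \<open>e 0\<close> to all basis vectors except its partner \<open>f 0\<close>, to which it is
  not orthogonal; \<open>f 0\<close> is reached from \<open>e 1\<close>.\<close>

lemma fixes_singular_lines_imp_scalar:
  assumes g: "g \<in> carrier OG" and lines: "\<And>p. N p = 0 \<Longrightarrow> \<exists>c. g p = c \<odot> p"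
  shows "\<exists>c. \<forall>v. g v = c \<odot> v"
proof -
  have n: "0 < n" "1 < n"
    using three_le_n by auto
  obtain c where c: "g (e 0) = c \<odot> e 0"
    using lines singular_e n by blast
  have ne: "g (e j) = c \<odot> e j" "g (f j) = c \<odot> f j" if "j < n" "j \<noteq> 0" for j
    by (rule scalar_on_singular_pair[OF g lines, of "e 0" "f 0" _ "f j"]
             scalar_on_singular_pair[OF g lines, of "e 0" "f 0" _ "e j"];
        use that n c in \<open>simp add: basis_polar singular_e singular_f\<close>)+
  have "g (f 0) = c \<odot> f 0"
    by (rule scalar_on_singular_pair[OF g lines, of "e 1" "f 1" _ "e 0"])
      (use ne[of 1] n in \<open>simp_all add: basis_polar singular_e singular_f\<close>)
  with ne c have all: "g (e j) = c \<odot> e j" "g (f j) = c \<odot> f j" if "j < n" for j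
    using that by (cases "j = 0"; simp)+
  have "g v = c \<odot> v" for v
    by (subst (1 2) expand[of v])
      (simp add: all g OG_sum OG_add OG_scale scale_sum_right scale_right_distrib mult.commute)
  then show ?thesis by blast
qed

lemma siegel_self_fixes: "N u = 0 \<Longrightarrow> B u w = 0 \<Longrightarrow> siegel u w u = u"
  by (simp add: siegel_def polar_self)

text \<open>A version of Iwasawa's argument.  A nonscalar \<open>h \<in> K\<close> yields an element of \<open>K\<close> that moves some
  singular vector to a vector not orthogonal to it; conjugating it, one sees that any two
  non-orthogonal singular lines are in the same orbit of \<open>K\<close>, and links then make \<open>K\<close> transitive on all singular
  lines.  So each \<open>siegel a b\<close> is conjugate under \<open>K\<close> to a \<open>siegel (e 0) v\<close>, which commutes with every
  \<open>siegel (e 0) w\<close>; hence the commutators required by \<open>siegel_group_le\<close> fall into \<open>K\<close>.  It is not assumed that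
  \<open>K\<close> is contained in the Siegel group, so the theorem also serves to show that a given normal
  subgroup of the orthogonal group contains it.\<close>

theorem siegel_group_minimal:
  assumes K: "subgroup K OG"
    and conj: "\<And>t k. t \<in> siegel_group \<Longrightarrow> k \<in> K \<Longrightarrow> t \<circ> k \<circ> inv\<^bsub>OG\<^esub> t \<in> K"
    and h: "h \<in> K" "\<nexists>c. \<forall>v. h v = c \<odot> v"
  shows "siegel_group \<subseteq> K"
proof -
  interpret K: subgroup K OG
    by (rule K)
  have n: "0 < n"
    using three_le_n by simp
  have e0: "N (e 0) = 0" "B (e 0) (e 0) = 0"
    using n by (simp_all add: singular_e basis_polar)
  have e0_nz: "e 0 \<noteq> 0"
    using basis_polar(1)[OF n n] polar_zero_left[of "f 0"] by auto
  have KO: "k \<in> carrier OG" if "k \<in> K" for k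
    using that K.subset by auto
  have opposite: "\<exists>p k. N p = 0 \<and> k \<in> K \<and> B p (k p) \<noteq> 0"
  proof -
    obtain p where p: "N p = 0" "\<And>c. h p \<noteq> c \<odot> p"
      using fixes_singular_lines_imp_scalar[OF KO[OF h(1)]] h(2) by blast
    have "p \<noteq> 0"
      using p(2)[of 0] OG_zero[OF KO[OF h(1)]] by auto
    then obtain t where t: "t \<in> siegel_group" "t p = e 0"
      using siegel_group_to_e0 p by blast
    have tO: "t \<in> carrier OG"
      using t siegel_group_in_OG by blast
    define k where "k = t \<circ> h \<circ> inv\<^bsub>OG\<^esub> t"
    have k: "k \<in> K"
      unfolding k_def using conj t h by blast
    have ti: "(inv\<^bsub>OG\<^esub> t) (e 0) = p"
      using tO by (simp flip: t(2))
    define q where "q = k (e 0)"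
    have q0: "N q = 0"
      unfolding q_def using OG_norm[OF KO[OF k]] e0 by simp
    have q: "q \<noteq> c \<odot> e 0" for c
    proof
      assume "q = c \<odot> e 0"
      then have "t (h p) = t (c \<odot> p)"
        by (simp add: q_def k_def ti OG_scale[OF tO] t)
      then show False
        using p(2)[of c] OG_bij[OF tO] by (metis bij_pointE)
    qed
    show ?thesis
    proof (cases "B q (e 0) = 0")
      case False
      then show ?thesis
        using e0 k by (intro exI[of _ "e 0"] exI[of _ k]) (auto simp: q_def polar_commute)
    next
      case True
      have "\<exists>i<n. i \<noteq> 0 \<and> (B q (e i) \<noteq> 0 \<or> B q (f i) \<noteq> 0)"
      proof (rule ccontr)
        assume not: "\<not> ?thesis"
        have "(\<Sum>i\<in>{..<n} - {0}. B q (f i) \<odot> e i + B q (e i) \<odot> f i) = 0"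
          using not by (intro sum.neutral) auto
        then have "q = B q (f 0) \<odot> e 0"
          using expand[of q] n True
            sum.remove[of "{..<n}" 0 "\<lambda>i. B q (f i) \<odot> e i + B q (e i) \<odot> f i"]
          by simp
        with q show False by blast
      qed
      then obtain i a where i: "i < n" "i \<noteq> 0" and a: "a \<in> {e i, f i}" "B q a \<noteq> 0"
        by blast
      define j :: nat where "j = (if i = 1 then 2 else 1)"
      have j: "j < n" "j \<noteq> 0" "j \<noteq> i"
        using three_le_n by (auto simp: j_def)
      \<comment> \<open>\<open>w\<close> is nonsingular and orthogonal to \<open>e 0\<close> and \<open>a\<close>, so \<open>siegel a w\<close> fixes \<open>e 0\<close> and moves
        \<open>q\<close> to a vector with product \<open>- (B q a)\<^sup>2\<close> with \<open>q\<close>\<close>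
      define w where "w = e j + f j"
      have w: "N w = 1" "B a w = 0" "B (e 0) w = 0" "B w a = 0"
        using i j a n by (auto simp: w_def N_simps polar_simps basis_polar singular_e singular_f)
      have a0: "N a = 0" "B (e 0) a = 0"
        using i a n by (auto simp: singular_e singular_f basis_polar)
      define g where "g = siegel a w"
      have g: "g \<in> siegel_group"
        unfolding g_def using a0 w siegel_in_siegel_group by blast
      have gO: "g \<in> carrier OG"
        using g siegel_group_in_OG by blast
      have "g (e 0) = e 0"
        using a0 w by (simp add: g_def siegel_def)
      then have gi: "(inv\<^bsub>OG\<^esub> g) (e 0) = e 0"
        using gO by (metis OG_inv_apply(2))
      \<comment> \<open>since \<open>g\<close> fixes \<open>e 0\<close>, the commutator of \<open>g\<close> and \<open>k\<close> carries \<open>k (e 0) = q\<close> to \<open>g q\<close>\<close>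
      define k' where "k' = (g \<circ> k \<circ> inv\<^bsub>OG\<^esub> g) \<circ> inv\<^bsub>OG\<^esub> k"
      have "k' \<in> K"
        unfolding k'_def using K.m_closed[OF conj[OF g k] K.m_inv_closed[OF k]] by simp
      moreover have "k' q = g q"
        using KO[OF k] by (simp add: k'_def q_def gi)
      moreover have "B q (g q) \<noteq> 0"
        using a w q0 by (simp add: g_def siegel_def polar_simps polar_self polar_commute[of a q]
            polar_commute[of w q] power2_eq_square)
      ultimately show ?thesis
        using q0 by metis
    qed
  qed
  then obtain p0 k0 where p0: "N p0 = 0" "k0 \<in> K" "B p0 (k0 p0) \<noteq> 0"
    by blast
  have p0_nz: "p0 \<noteq> 0"
    using p0 by (auto simp: polar_zero_left)
  obtain t0 where t0: "t0 \<in> siegel_group" "t0 p0 = e 0"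
    using siegel_group_to_e0[OF p0(1) p0_nz] .
  have opp: "\<exists>k\<in>K. \<exists>c. c \<noteq> 0 \<and> k p = c \<odot> q" if pq: "N p = 0" "N q = 0" "B p q \<noteq> 0" for p q
  proof -
    have "p \<noteq> 0"
      using pq by (auto simp: polar_zero_left)
    then obtain t1 where t1: "t1 \<in> siegel_group" "t1 p = e 0"
      using siegel_group_to_e0 pq by blast
    have O: "t0 \<in> carrier OG" "t1 \<in> carrier OG"
      using t0 t1 siegel_group_in_OG by auto
    define t where "t = inv\<^bsub>OG\<^esub> t1 \<circ> t0"
    have t: "t \<in> siegel_group"
      unfolding t_def using t0 t1 by (simp add: siegel_group_comp)
    have tO: "t \<in> carrier OG"
      using t siegel_group_in_OG by blast
    have tp: "t p0 = p"
      using OG_inv_apply(2)[OF O(2), of p] t0 t1 by (simp add: t_def)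
    have ti: "(inv\<^bsub>OG\<^esub> t) p = p0"
      using OG_inv_apply(2)[OF tO, of p0] tp by simp
    define k where "k = t \<circ> k0 \<circ> inv\<^bsub>OG\<^esub> t"
    have k: "k \<in> K"
      unfolding k_def using conj t p0 by blast
    define s where "s = k p"
    have s: "N s = 0" "B s p \<noteq> 0"
      using OG_polar[OF tO, of "k0 p0" p0] p0 pq KO[OF k]
      by (simp_all add: s_def OG_norm) (simp add: k_def ti tp polar_commute)
    \<comment> \<open>\<open>k\<close> sends \<open>p\<close> to \<open>s\<close>; a Siegel transformation of \<open>p\<close> fixes \<open>p\<close> and takes \<open>s\<close> to the multiple of
      \<open>q\<close> with the same product with \<open>p\<close>\<close>
    define c where "c = B s p / B p q"
    have c: "c \<noteq> 0" "B s p = B (c \<odot> q) p"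
      using s pq by (simp_all add: c_def polar_simps polar_commute[of q p])
    define g where "g = siegel p (inverse (B s p) \<odot> (c \<odot> q - s))"
    have ortho: "g s = c \<odot> q" "B p (inverse (B s p) \<odot> (c \<odot> q - s)) = 0"
      using siegel_moves[of s "c \<odot> q" p] s c pq by (simp_all add: g_def N_scale)
    have g: "g \<in> siegel_group"
      unfolding g_def using ortho pq siegel_in_siegel_group by blast
    have gO: "g \<in> carrier OG"
      using g siegel_group_in_OG by blast
    have "g p = p"
      unfolding g_def using ortho pq by (simp add: siegel_self_fixes)
    then have "(inv\<^bsub>OG\<^esub> g) p = p"
      using gO by (metis OG_inv_apply(2))
    then have "(g \<circ> k \<circ> inv\<^bsub>OG\<^esub> g) p = c \<odot> q"
      using ortho by (simp add: s_def)
    then show ?thesis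
      using conj[OF g k] c by blast
  qed
  have trans: "\<exists>k\<in>K. \<exists>c. c \<noteq> 0 \<and> k p = c \<odot> e 0" if p: "N p = 0" "p \<noteq> 0" for p
    using link_chain_e0[OF p]
  proof (induction rule: converse_rtranclp_induct)
    case base
    show ?case
      using K.one_closed by (intro bexI[of _ id] exI[of _ 1]) auto
  next
    case (step p q)
    obtain k c where k: "k \<in> K" "c \<noteq> 0" "k q = c \<odot> e 0"
      using step.IH by blast
    obtain r where r: "N p = 0" "N q = 0" "N r = 0" "B p r \<noteq> 0" "B r q \<noteq> 0"
      using step.hyps(1) by (auto simp: link_def polar_commute[of _ q])
    obtain k1 c1 where k1: "k1 \<in> K" "c1 \<noteq> 0" "k1 p = c1 \<odot> r"
      using opp[of p r] r by blast
    obtain k2 c2 where k2: "k2 \<in> K" "c2 \<noteq> 0" "k2 r = c2 \<odot> q"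
      using opp[of r q] r by blast
    have "(k \<circ> k2 \<circ> k1) p = (c1 * c2 * c) \<odot> e 0"
      using k k1 k2 KO by (simp add: OG_scale)
    moreover have "k \<circ> k2 \<circ> k1 \<in> K"
      using K.m_closed[OF K.m_closed[OF k(1) k2(1)] k1(1)] by simp
    ultimately show ?case
      using k k1 k2 by (metis mult_eq_0_iff)
  qed
  show ?thesis
  proof (rule siegel_group_le[OF K conj])
    fix w a b
    assume w: "B (e 0) w = 0" and a: "N a = 0" and b: "B a b = 0"
    define x where "x = siegel (e 0) w"
    have x: "x \<in> siegel_group"
      unfolding x_def using w e0 siegel_in_siegel_group by blast
    have xO: "x \<in> carrier OG"
      using x siegel_group_in_OG by blast
    show "siegel (e 0) w \<circ> siegel a b \<circ> inv\<^bsub>OG\<^esub> (siegel (e 0) w) \<circ> inv\<^bsub>OG\<^esub> (siegel a b) \<in> K"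
    proof (cases "a = 0")
      case True
      then have "siegel a b = id"
        by (auto simp: siegel_def polar_simps)
      then show ?thesis
        using xO K.one_closed OG.r_inv[OF xO] OG.inv_one unfolding x_def[symmetric]
        by simp
    next
      case False
      obtain k c where k: "k \<in> K" "c \<noteq> 0" "k a = c \<odot> e 0"
        using trans[OF a False] by blast
      have kO: "k \<in> carrier OG"
        using KO k by blast
      define u where "u = siegel (e 0) (c \<odot> k b)"
      have ort: "B (e 0) (c \<odot> k b) = 0"
        using OG_polar[OF kO, of a b] b k by (simp add: polar_simps)
      have u: "u \<in> siegel_group"
        unfolding u_def using ort e0 siegel_in_siegel_group by blast
      have uO: "u \<in> carrier OG"
        using u siegel_group_in_OG by blast
      have ku: "k \<circ> siegel a b \<circ> inv\<^bsub>OG\<^esub> k = u"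
        using siegel_conj[OF kO, of a b] k by (simp add: u_def siegel_scale)
      have sab: "siegel a b \<in> carrier OG"
        using a b siegel_in_OG by blast
      define y where "y = inv\<^bsub>OG\<^esub> u \<circ> inv\<^bsub>OG\<^esub> k \<circ> u \<circ> k"
      have "inv\<^bsub>OG\<^esub> u \<circ> inv\<^bsub>OG\<^esub> k \<circ> inv\<^bsub>OG\<^esub> (inv\<^bsub>OG\<^esub> u) \<in> K"
        using u k by (intro conj K.m_inv_closed) auto
      then have y: "y \<in> K"
        unfolding y_def using K.m_closed[OF _ k(1)] uO by simp
      have "u (k v) = k (siegel a b v)" for v
        using fun_cong[OF ku, of "k v"] kO by simp
      then have "siegel a b = u \<circ> y"
        using kO uO by (simp add: y_def fun_eq_iff)
      moreover have "x \<circ> u = u \<circ> x"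
        using w ort e0 by (simp add: x_def u_def siegel_add add.commute)
      ultimately show ?thesis
        using OG.commutator_with_conjugate[OF K xO uO _ y] conj[OF x y] conj[OF u]
        by (simp add: x_def)
    qed
  qed
qed


section \<open>Reflections\<close>

text \<open>The orthogonal reflection in a vector of norm 1; in characteristic 2 it is a transvection.\<close>

definition reflection :: "'v \<Rightarrow> 'v \<Rightarrow> 'v" where
  "reflection a v = v - B v a \<odot> a"

lemma reflection_involution: "N a = 1 \<Longrightarrow> reflection a (reflection a v) = v"
  by (rule vector_eqI) (simp add: reflection_def polar_simps polar_self algebra_simps)

lemma reflection_in_OG:
  assumes "N a = 1"
  shows "reflection a \<in> carrier OG"
  unfolding carrier_OG_iff
proof (intro conjI allI)
  show "reflection a (x + y) = reflection a x + reflection a y" for x y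
    by (rule vector_eqI) (simp add: reflection_def polar_simps algebra_simps)
  show "reflection a (c \<odot> x) = c \<odot> reflection a x" for c x
    by (rule vector_eqI) (simp add: reflection_def polar_simps algebra_simps)
  show "bij (reflection a)"
    using reflection_involution[OF assms] by (intro o_bij[of "reflection a"]) auto
  show "N (reflection a x) = N x" for x
    using assms by (simp add: reflection_def N_simps polar_simps power2_eq_square)
qed

lemma inv_reflection: "N a = 1 \<Longrightarrow> inv\<^bsub>OG\<^esub> (reflection a) = reflection a"
  by (intro OG.inv_equality) (auto simp: reflection_in_OG reflection_involution)

lemma reflection_conj:
  assumes g: "g \<in> carrier OG"
  shows "g \<circ> reflection a \<circ> inv\<^bsub>OG\<^esub> g = reflection (g a)"
proof
  fix v
  have "B ((inv\<^bsub>OG\<^esub> g) v) a = B v (g a)"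
    using OG_polar[OF g, of "(inv\<^bsub>OG\<^esub> g) v" a] g by simp
  then show "(g \<circ> reflection a \<circ> inv\<^bsub>OG\<^esub> g) v = reflection (g a) v"
    using g by (simp add: reflection_def OG_diff OG_scale)
qed

text \<open>The products of two such reflections generate a normal subgroup of the orthogonal group, which has
  nonscalar elements, so \<open>siegel_group_minimal\<close> applies.\<close>

theorem siegel_group_le_reflection_products:
  "siegel_group \<subseteq> generate OG {reflection a \<circ> reflection b |a b. N a = 1 \<and> N b = 1}"
    (is "_ \<subseteq> generate OG ?S")
proof -
  have "generate OG ?S \<lhd> OG"
  proof (rule OG.normal_generateI)
    show "?S \<subseteq> carrier OG"
      using reflection_in_OG OG_comp by auto
    fix h g
    assume "h \<in> ?S" and g: "g \<in> carrier OG"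
    then obtain a b where h: "h = reflection a \<circ> reflection b" "N a = 1" "N b = 1"
      by auto
    have "g \<circ> h \<circ> inv\<^bsub>OG\<^esub> g
        = (g \<circ> reflection a \<circ> inv\<^bsub>OG\<^esub> g) \<circ> (g \<circ> reflection b \<circ> inv\<^bsub>OG\<^esub> g)"
      using g by (simp add: h fun_eq_iff)
    also have "\<dots> = reflection (g a) \<circ> reflection (g b)"
      unfolding reflection_conj[OF g] ..
    finally have "g \<circ> h \<circ> inv\<^bsub>OG\<^esub> g = reflection (g a) \<circ> reflection (g b)" .
    moreover have "N (g a) = 1" "N (g b) = 1"
      using h OG_norm[OF g] by simp_all
    ultimately show "g \<otimes>\<^bsub>OG\<^esub> h \<otimes>\<^bsub>OG\<^esub> inv\<^bsub>OG\<^esub> g \<in> ?S"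
      unfolding mult_OG by blast
  qed
  then interpret S: normal "generate OG ?S" OG .
  have n: "0 < n" "1 < n" "2 < n"
    using three_le_n by auto
  define a b where "a = e 0 + f 0" and "b = e 1 + f 1"
  define h where "h = reflection a \<circ> reflection b"
  have ab: "N a = 1" "N b = 1"
    using n by (simp_all add: a_def b_def N_simps singular_e singular_f basis_polar)
  show ?thesis
  proof (rule siegel_group_minimal)
    show "subgroup (generate OG ?S) OG"
      by (rule S.subgroup_axioms)
    show "t \<circ> k \<circ> inv\<^bsub>OG\<^esub> t \<in> generate OG ?S"
      if "t \<in> siegel_group" "k \<in> generate OG ?S" for t k
      using S.inv_op_closed2[of t k] that siegel_group_in_OG by simp
    show "h \<in> generate OG ?S"
      using ab unfolding h_def by (intro generate.incl) auto
    show "\<nexists>c. \<forall>v. h v = c \<odot> v"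
    proof
      assume "\<exists>c. \<forall>v. h v = c \<odot> v"
      then obtain c where c: "\<And>v. h v = c \<odot> v"
        by blast
      have "h (e 2) = e 2" "h (e 0) = - f 0"
        using n by (simp_all add: h_def reflection_def a_def b_def polar_simps basis_polar)
      then have "B (c \<odot> e 0) (e 0) = B (- f 0) (e 0)"
        using c by simp
      then show False
        using n by (simp add: polar_simps basis_polar)
    qed
  qed
qed

end

section \<open>The split octonions as a hyperbolic space\<close>

text \<open>The minus sign in \<open>zorn_f\<close> compensates for the one in the norm \<open>a b - \<alpha> \<cdot> \<beta>\<close>.\<close>

definition zorn_e :: "nat \<Rightarrow> 'a::field zorn" where
  "zorn_e i = (if i = 0 then Zorn 1 0 0 0 else Zorn 0 (axis (of_nat i) 1) 0 0)"

definition zorn_f :: "nat \<Rightarrow> 'a::field zorn" where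
  "zorn_f i = (if i = 0 then Zorn 0 0 0 1 else Zorn 0 0 (- axis (of_nat i) 1) 0)"

lemmas zorn_coords = dot_def cross_def sum_3 vec_eq_iff forall_3

lemma polar_zorn:
  "polar zorn_norm (Zorn a \<alpha> \<beta> b) (Zorn c \<gamma> \<delta> d) = a * d + b * c - dot \<alpha> \<delta> - dot \<beta> \<gamma>"
  by (simp add: polar_def dot_def sum_3 algebra_simps)

lemma less_4_cases: "i < 4 \<longleftrightarrow> i = 0 \<or> i = 1 \<or> i = 2 \<or> i = (3::nat)"
  by auto

lemma lessThan_4: "{..<4::nat} = {0, 1, 2, 3}"
  by auto

interpretation zorn: hyperbolic_space zorn_scale "zorn_norm :: 'a::field zorn \<Rightarrow> 'a" zorn_e zorn_f 4
proof (intro hyperbolic_space.intro hyperbolic_space_axioms.intro vector_space_zorn)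
  show "zorn_norm (zorn_scale c x) = c\<^sup>2 * zorn_norm x" for c and x :: "'a zorn"
    by (cases x) (simp add: zorn_coords power2_eq_square algebra_simps)
  show "polar zorn_norm (x + y) z = polar zorn_norm x z + polar zorn_norm y z" for x y z :: "'a zorn"
    by (cases x; cases y; cases z) (simp add: polar_zorn zorn_coords algebra_simps)
  show "polar zorn_norm (zorn_scale c x) z = c * polar zorn_norm x z" for c and x z :: "'a zorn"
    by (cases x; cases z) (simp add: polar_zorn zorn_coords algebra_simps)
  show "zorn_norm (zorn_e i :: 'a zorn) = 0" "zorn_norm (zorn_f i :: 'a zorn) = 0" for i
    by (simp_all add: zorn_e_def zorn_f_def zorn_coords)
  show "polar zorn_norm (zorn_e i :: 'a zorn) (zorn_f j) = (if i = j then 1 else 0)"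
    if "i < 4" "j < 4" for i j
    using that unfolding less_4_cases
    by (auto simp: zorn_e_def zorn_f_def polar_zorn zorn_coords axis_def)
  show "polar zorn_norm (zorn_e i :: 'a zorn) (zorn_e j) = 0"
    "polar zorn_norm (zorn_f i :: 'a zorn) (zorn_f j) = 0" for i j
    by (simp_all add: zorn_e_def zorn_f_def polar_zorn zorn_coords)
  show "v = (\<Sum>i<4. zorn_scale (polar zorn_norm v (zorn_f i)) (zorn_e i) +
      zorn_scale (polar zorn_norm v (zorn_e i)) (zorn_f i))" for v :: "'a zorn"
    by (cases v) (simp add: lessThan_4 zorn_e_def zorn_f_def polar_zorn zorn_coords axis_def)
qed simp

lemma zorn_distrib:
  fixes x y z :: "'a::field zorn"
  shows "x * (y + z) = x * y + x * z" "(x + y) * z = x * z + y * z"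
    "x * zorn_scale c y = zorn_scale c (x * y)" "zorn_scale c x * y = zorn_scale c (x * y)"
    "1 * x = x" "x * 1 = x" "(- x) * y = - (x * y)" "x * (- y) = - (x * y)"
  by (cases x; cases y; cases z; simp add: one_zorn_def zorn_coords algebra_simps)+

fun zorn_conj :: "'a::field zorn \<Rightarrow> 'a zorn" where
  "zorn_conj (Zorn a \<alpha> \<beta> b) = Zorn b (- \<alpha>) (- \<beta>) a"

lemma zorn_conj_cancel:
  "zorn_conj x * (x * y) = zorn_scale (zorn_norm x) y"
  "x * (zorn_conj x * y) = zorn_scale (zorn_norm x) y"
  "(y * x) * zorn_conj x = zorn_scale (zorn_norm x) y"
  "(y * zorn_conj x) * x = zorn_scale (zorn_norm x) y"
  "zorn_conj x * x = zorn_scale (zorn_norm x) 1"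
  "zorn_norm (zorn_conj x) = zorn_norm x"
  by (cases x; cases y; simp add: one_zorn_def zorn_coords algebra_simps)+

lemma zorn_moufang: "(x * y) * (z * x) = (x * (y * z)) * (x :: 'a::field zorn)"
  by (cases x; cases y; cases z) (simp add: zorn_coords algebra_simps)

text \<open>The formula that links multiplications to reflections: \<open>- zorn_conj v\<close> is the reflection of \<open>v\<close> in 1, and
  for \<open>N a = 1\<close> the right-hand side is the reflection of \<open>- zorn_conj v\<close> in \<open>a\<close>.\<close>

lemma zorn_sandwich:
  "(a * v) * a = zorn_scale (polar zorn_norm (zorn_conj v) a) a - zorn_scale (zorn_norm a) (zorn_conj v)"
  by (cases a; cases v) (simp add: polar_zorn zorn_coords algebra_simps)

section \<open>Multiplications by elements of norm 1\<close>

lemma left_mult_in_OG: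
  assumes "zorn_norm x = 1"
  shows "(*) x \<in> carrier zorn.OG"
  unfolding zorn.carrier_OG_iff
  using assms zorn_conj_cancel(1,2)[of x]
  by (auto simp: zorn_distrib zorn_norm_mult fun_eq_iff intro!: o_bij[of "(*) (zorn_conj x)"])

lemma right_mult_in_OG:
  assumes "zorn_norm x = 1"
  shows "(\<lambda>y. y * x) \<in> carrier zorn.OG"
  unfolding zorn.carrier_OG_iff
  using assms zorn_conj_cancel(3,4)[where x = x]
  by (auto simp: zorn_distrib zorn_norm_mult fun_eq_iff intro!: o_bij[of "\<lambda>y. y * zorn_conj x"])

lemma cross_surj:
  fixes \<alpha> :: "'a::field ^ 3"
  obtains \<beta> \<gamma> where "\<alpha> = cross \<beta> \<gamma>"
proof -
  define a b c where "a = \<alpha> $ 1" "b = \<alpha> $ 2" "c = \<alpha> $ 3"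
  note abc = this
  consider "a \<noteq> 0" | "b \<noteq> 0" | "c \<noteq> 0" | "\<alpha> = 0"
    by (auto simp: abc zorn_coords)
  then show ?thesis
  proof cases
    case 1
    then have "\<alpha> = cross (vector [- b, a, 0]) (vector [- c / a, 0, 1])"
      by (auto simp: zorn_coords simp flip: abc)
    then show ?thesis by (rule that)
  next
    case 2
    then have "\<alpha> = cross (vector [0, - c, b]) (vector [1, - a / b, 0])"
      by (auto simp: zorn_coords simp flip: abc)
    then show ?thesis by (rule that)
  next
    case 3
    then have "\<alpha> = cross (vector [c, 0, - a]) (vector [0, 1, - b / c])"
      by (auto simp: zorn_coords simp flip: abc)
    then show ?thesis by (rule that)
  next
    case 4
    then have "\<alpha> = cross 0 0"
      by (simp add: zorn_coords)
    then show ?thesis by (rule that)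
  qed
qed

text \<open>On \<open>Zorn c \<gamma> \<delta> d\<close>, the left multiplication adds \<open>\<alpha> \<cdot> \<delta>\<close> to the first diagonal entry, a multiple of \<open>\<alpha>\<close> to the first
  vector and \<open>\<alpha> \<times> \<gamma>\<close> to the second.  The first two changes form one Siegel transformation; the last
  one is another as soon as \<open>\<alpha>\<close> is written as a cross product, by the expansion of the
  triple product.\<close>

lemma left_mult_upper: "(*) (Zorn 1 \<alpha> 0 1) \<in> zorn.siegel_group"
proof -
  obtain \<beta> \<gamma> where \<alpha>: "\<alpha> = cross \<gamma> \<beta>"
    by (rule cross_surj)
  have "(*) (Zorn 1 \<alpha> 0 1)
      = zorn.siegel (Zorn 1 0 0 0) (Zorn 0 \<alpha> 0 0) \<circ> zorn.siegel (Zorn 0 0 \<beta> 0) (Zorn 0 0 \<gamma> 0)"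
  proof
    fix v show "Zorn 1 \<alpha> 0 1 * v
      = (zorn.siegel (Zorn 1 0 0 0) (Zorn 0 \<alpha> 0 0) \<circ> zorn.siegel (Zorn 0 0 \<beta> 0) (Zorn 0 0 \<gamma> 0)) v"
      by (cases v) (simp add: \<alpha> zorn.siegel_def polar_zorn zorn_coords algebra_simps)
  qed
  also have "\<dots> \<in> zorn.siegel_group"
    by (intro zorn.siegel_group_comp zorn.siegel_in_siegel_group)
      (simp_all add: polar_zorn zorn_coords)
  finally show ?thesis .
qed

lemma left_mult_lower: "(*) (Zorn 1 0 \<alpha> 1) \<in> zorn.siegel_group"
proof -
  obtain \<beta> \<gamma> where \<alpha>: "\<alpha> = cross \<beta> \<gamma>"
    by (rule cross_surj)
  have "(*) (Zorn 1 0 \<alpha> 1)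
      = zorn.siegel (Zorn 0 0 0 1) (Zorn 0 0 \<alpha> 0) \<circ> zorn.siegel (Zorn 0 \<beta> 0 0) (Zorn 0 \<gamma> 0 0)"
  proof
    fix v show "Zorn 1 0 \<alpha> 1 * v
      = (zorn.siegel (Zorn 0 0 0 1) (Zorn 0 0 \<alpha> 0) \<circ> zorn.siegel (Zorn 0 \<beta> 0 0) (Zorn 0 \<gamma> 0 0)) v"
      by (cases v) (simp add: \<alpha> zorn.siegel_def polar_zorn zorn_coords algebra_simps)
  qed
  also have "\<dots> \<in> zorn.siegel_group"
    by (intro zorn.siegel_group_comp zorn.siegel_in_siegel_group)
      (simp_all add: polar_zorn zorn_coords)
  finally show ?thesis .
qed

text \<open>By the Moufang identity, \<open>L (x y) \<circ> R x = L x \<circ> R x \<circ> L y\<close>; so \<open>L y\<close> is conjugate under \<open>R x\<close> to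
  \<open>(L x)\<^sup>-\<^sup>1 \<circ> L (x y)\<close>.  Since the Siegel group is normal in the whole orthogonal group, nothing
  needs to be known about \<open>R x\<close>.\<close>

lemma left_mult_cancel:
  assumes x: "zorn_norm x = 1" "(*) x \<in> zorn.siegel_group"
    and xy: "(*) (x * y) \<in> zorn.siegel_group" and y: "zorn_norm y = 1"
  shows "(*) y \<in> zorn.siegel_group"
proof -
  define R where "R = (\<lambda>z. z * x)"
  have R: "R \<in> carrier zorn.OG"
    unfolding R_def using x right_mult_in_OG by blast
  have L: "(*) x \<in> carrier zorn.OG"
    using x left_mult_in_OG by blast
  define t where "t = inv\<^bsub>zorn.OG\<^esub> ((*) x) \<circ> (*) (x * y)"
  have t: "t \<in> zorn.siegel_group"
    unfolding t_def using x xy by (simp add: zorn.siegel_group_comp)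
  have "R (y * z) = t (R z)" for z
  proof -
    have "x * R (y * z) = (x * y) * R z"
    proof -
      have "x * R (y * z) = (x * (y * z)) * x"
        unfolding R_def
        by (cases x; cases "y * z") (simp add: zorn_coords algebra_simps)
      then show ?thesis
        unfolding R_def zorn_moufang .
    qed
    then have "t (R z) = (inv\<^bsub>zorn.OG\<^esub> ((*) x)) (x * R (y * z))"
      by (simp add: t_def)
    then show ?thesis
      using L by simp
  qed
  then have "(*) y = inv\<^bsub>zorn.OG\<^esub> R \<circ> t \<circ> R"
    using R by (metis (no_types, lifting) comp_apply ext zorn.OG_inv_apply(2))
  then show ?thesis
    using zorn.SG.inv_op_closed1[OF R t] by simp
qed

text \<open>Elementary row operations: multiplying \<open>x\<close> from the left by unitriangular elements makes the lower left
  vector nonzero, then the upper left entry 1, then the lower left vector 0, which leaves a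
  unitriangular element.\<close>

theorem left_mult_in_siegel_group:
  fixes x :: "'a::field zorn"
  assumes "zorn_norm x = 1"
  shows "(*) x \<in> zorn.siegel_group"
proof -
  have one: "(*) (Zorn 1 \<alpha> \<beta> b) \<in> zorn.siegel_group"
    if "zorn_norm (Zorn 1 \<alpha> \<beta> b) = 1" for \<alpha> \<beta> and b :: 'a
  proof (rule left_mult_cancel[OF _ left_mult_lower[of "- \<beta>"] _ that])
    have n: "zorn_norm (Zorn 1 0 (- \<beta>) 1) = 1"
      by (simp add: zorn_coords)
    then show "zorn_norm (Zorn 1 0 (- \<beta>) 1) = 1" .
    obtain \<alpha>' b' where e: "Zorn 1 0 (- \<beta>) 1 * Zorn 1 \<alpha> \<beta> b = Zorn 1 \<alpha>' 0 b'"
      by (simp add: zorn_coords)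
    have "zorn_norm (Zorn 1 \<alpha>' 0 b') = 1"
      unfolding e[symmetric] zorn_norm_mult using n that by simp
    then have "b' = 1"
      by (simp add: zorn_coords)
    then show "(*) (Zorn 1 0 (- \<beta>) 1 * Zorn 1 \<alpha> \<beta> b) \<in> zorn.siegel_group"
      using e left_mult_upper by metis
  qed
  have lower: "(*) (Zorn a \<alpha> \<beta> b) \<in> zorn.siegel_group"
    if nx: "zorn_norm (Zorn a \<alpha> \<beta> b) = 1" and nz: "\<beta> \<noteq> 0" for \<alpha> \<beta> and a b :: 'a
  proof -
    obtain i where i: "\<beta> $ i \<noteq> 0"
      using nz by (auto simp: vec_eq_iff)
    define \<kappa> where "\<kappa> = axis i ((1 - a) / \<beta> $ i)"
    have d: "dot \<kappa> \<beta> = 1 - a"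
      using i by (simp add: \<kappa>_def dot_def axis_def if_distrib if_distribR cong: if_cong)
    have n: "zorn_norm (Zorn 1 \<kappa> 0 1) = 1"
      by (simp add: zorn_coords)
    obtain \<alpha>' \<beta>' b' where e: "Zorn 1 \<kappa> 0 1 * Zorn a \<alpha> \<beta> b = Zorn 1 \<alpha>' \<beta>' b'"
      by (simp add: d)
    have "zorn_norm (Zorn 1 \<alpha>' \<beta>' b') = 1"
      unfolding e[symmetric] zorn_norm_mult using n nx by simp
    then have "(*) (Zorn 1 \<kappa> 0 1 * Zorn a \<alpha> \<beta> b) \<in> zorn.siegel_group"
      unfolding e by (rule one)
    then show ?thesis
      using left_mult_cancel[OF n left_mult_upper _ nx] by blast
  qed
  obtain a \<alpha> \<beta> b where x: "x = Zorn a \<alpha> \<beta> b"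
    by (cases x)
  show ?thesis
  proof (cases "\<beta> = 0")
    case False
    with lower assms x show ?thesis by blast
  next
    case True
    then have a: "a \<noteq> 0"
      using assms x by (auto simp: zorn_coords)
    define \<mu> :: "'a ^ 3" where "\<mu> = axis 1 1"
    have n: "zorn_norm (Zorn 1 0 \<mu> 1) = 1"
      by (simp add: zorn_coords)
    obtain a' \<alpha>' b' where e: "Zorn 1 0 \<mu> 1 * x = Zorn a' \<alpha>' (a *s \<mu>) b'"
      by (simp add: x True) (simp add: zorn_coords)
    have "zorn_norm (Zorn a' \<alpha>' (a *s \<mu>) b') = 1"
      unfolding e[symmetric] zorn_norm_mult using n assms by simp
    moreover have "a *s \<mu> \<noteq> 0"
      using a by (auto simp: \<mu>_def vec_eq_iff axis_def)
    ultimately have "(*) (Zorn 1 0 \<mu> 1 * x) \<in> zorn.siegel_group"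
      unfolding e by (rule lower)
    then show ?thesis
      using left_mult_cancel[OF n left_mult_lower _ assms] by blast
  qed
qed

definition zorn_translations :: "('a::field zorn \<Rightarrow> 'a zorn) set" where
  "zorn_translations = {(*) x |x. zorn_norm x = 1} \<union> {(\<lambda>y. y * x) |x. zorn_norm x = 1}"

lemma zorn_translations_in_OG: "zorn_translations \<subseteq> carrier zorn.OG"
  unfolding zorn_translations_def using left_mult_in_OG right_mult_in_OG by blast

lemma reflection_one: "zorn.reflection 1 v = - zorn_conj v"
  by (cases v) (simp add: zorn.reflection_def polar_zorn one_zorn_def zorn_coords)

lemma norm_one: "zorn_norm (1 :: 'a::field zorn) = 1"
  by (simp add: one_zorn_def zorn_coords)

lemma bimult_eq_reflections:
  assumes "zorn_norm a = 1"
  shows "(\<lambda>y. y * a) \<circ> (*) a = zorn.reflection a \<circ> zorn.reflection 1"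
proof
  fix v
  have "polar zorn_norm (- zorn_conj v) a = - polar zorn_norm (zorn_conj v) a"
    by (rule zorn.polar_minus_left)
  then show "((\<lambda>y. y * a) \<circ> (*) a) v = (zorn.reflection a \<circ> zorn.reflection 1) v"
    using assms by (simp add: zorn_sandwich reflection_one zorn.reflection_def[of a])
qed

text \<open>\<open>R a \<circ> L a\<close> is a product of two reflections, and these are conjugate under the left multiplication
  \<open>g\<close> by the conjugate of \<open>a\<close>, which takes \<open>a\<close> to 1.  So \<open>R a \<circ> L a\<close> is a commutator of \<open>g\<close> with a reflection, and \<open>g\<close>
  lies in the normal Siegel group.\<close>

lemma right_mult_in_siegel_group:
  assumes a: "zorn_norm a = 1"
  shows "(\<lambda>y. y * a) \<in> zorn.siegel_group"
proof -
  have L: "(*) a \<in> zorn.siegel_group" "(*) a \<in> carrier zorn.OG"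
    using a left_mult_in_siegel_group left_mult_in_OG by auto
  define g where "g = (*) (zorn_conj a)"
  have c: "zorn_norm (zorn_conj a) = 1"
    using a by (simp add: zorn_conj_cancel)
  have g: "g \<in> zorn.siegel_group" "g \<in> carrier zorn.OG"
    unfolding g_def using left_mult_in_siegel_group[OF c] left_mult_in_OG[OF c] by auto
  have ga: "g a = 1"
    unfolding g_def by (simp add: zorn_conj_cancel a)
  define r where "r = zorn.reflection a"
  have r: "r \<in> carrier zorn.OG" "inv\<^bsub>zorn.OG\<^esub> r = r"
    unfolding r_def using a zorn.reflection_in_OG zorn.inv_reflection by auto
  have "r \<circ> g \<circ> inv\<^bsub>zorn.OG\<^esub> r \<in> zorn.siegel_group"
    using zorn.SG.inv_op_closed2[OF r(1) g(1)] by simp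
  then have "(r \<circ> g \<circ> r) \<circ> inv\<^bsub>zorn.OG\<^esub> g \<in> zorn.siegel_group"
    using g(1) r(2) by (intro zorn.siegel_group_comp[of "r \<circ> g \<circ> r"]) auto
  moreover have "(r \<circ> g \<circ> r) \<circ> inv\<^bsub>zorn.OG\<^esub> g = r \<circ> zorn.reflection 1"
    using zorn.reflection_conj[OF g(2), of a] by (simp add: r_def ga comp_assoc)
  ultimately have "(\<lambda>y. y * a) \<circ> (*) a \<in> zorn.siegel_group"
    using bimult_eq_reflections[OF a] by (simp add: r_def)
  then have "((\<lambda>y. y * a) \<circ> (*) a) \<circ> inv\<^bsub>zorn.OG\<^esub> ((*) a) \<in> zorn.siegel_group"
    using L(1) by (intro zorn.siegel_group_comp[of "(\<lambda>y. y * a) \<circ> (*) a"]) auto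
  moreover have "((\<lambda>y. y * a) \<circ> (*) a) \<circ> inv\<^bsub>zorn.OG\<^esub> ((*) a) = (\<lambda>y. y * a)"
    using L by (simp add: fun_eq_iff)
  ultimately show ?thesis by simp
qed

text \<open>The products \<open>R a \<circ> L a\<close> yield all products of two reflections, and these
  generate a group containing the Siegel group.\<close>

theorem generate_zorn_translations:
  "generate zorn.OG zorn_translations = (zorn.siegel_group :: ('a::field zorn \<Rightarrow> 'a zorn) set)"
proof
  have "zorn_translations \<subseteq> (zorn.siegel_group :: ('a zorn \<Rightarrow> 'a zorn) set)"
    unfolding zorn_translations_def
    using left_mult_in_siegel_group right_mult_in_siegel_group by blast
  then show "generate zorn.OG zorn_translations \<subseteq> (zorn.siegel_group :: ('a zorn \<Rightarrow> 'a zorn) set)"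
    by (rule zorn.OG.generate_subgroup_incl[OF _ zorn.SG.subgroup_axioms])
  interpret G: subgroup "generate zorn.OG zorn_translations" "zorn.OG :: ('a zorn \<Rightarrow> 'a zorn) monoid"
    by (rule zorn.OG.generate_is_subgroup[OF zorn_translations_in_OG])
  have r1: "zorn.reflection a \<circ> zorn.reflection 1 \<in> generate zorn.OG zorn_translations"
    if "zorn_norm a = 1" for a :: "'a zorn"
  proof -
    have "(*) a \<in> generate zorn.OG zorn_translations" "(\<lambda>y. y * a) \<in> generate zorn.OG zorn_translations"
      using that unfolding zorn_translations_def by (auto intro!: generate.incl)
    then show ?thesis
      unfolding bimult_eq_reflections[OF that, symmetric] using G.m_closed by simp
  qed
  have "zorn.reflection a \<circ> zorn.reflection b \<in> generate zorn.OG zorn_translations"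
    if ab: "zorn_norm a = 1" "zorn_norm b = 1" for a b :: "'a zorn"
  proof -
    have "inv\<^bsub>zorn.OG\<^esub> (zorn.reflection b \<circ> zorn.reflection 1)
        = zorn.reflection 1 \<circ> zorn.reflection b"
      using zorn.OG.inv_mult_group[OF zorn.reflection_in_OG[OF ab(2)] zorn.reflection_in_OG[OF norm_one]]
      by (simp add: zorn.inv_reflection ab norm_one)
    then have "zorn.reflection 1 \<circ> zorn.reflection b \<in> generate zorn.OG zorn_translations"
      using G.m_inv_closed[OF r1[OF ab(2)]] by simp
    then have "(zorn.reflection a \<circ> zorn.reflection 1) \<circ> (zorn.reflection 1 \<circ> zorn.reflection b)
        \<in> generate zorn.OG zorn_translations"
      using G.m_closed[OF r1[OF ab(1)]] by simp
    moreover have "(zorn.reflection a \<circ> zorn.reflection 1) \<circ> (zorn.reflection 1 \<circ> zorn.reflection b)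
        = zorn.reflection a \<circ> zorn.reflection b"
      by (simp add: fun_eq_iff zorn.reflection_involution norm_one)
    ultimately show ?thesis by simp
  qed
  then have "generate zorn.OG {zorn.reflection a \<circ> zorn.reflection b |a b. zorn_norm a = 1 \<and> zorn_norm b = 1}
      \<subseteq> generate zorn.OG (zorn_translations :: ('a zorn \<Rightarrow> 'a zorn) set)"
    by (intro zorn.OG.generate_subgroup_incl G.subgroup_axioms) blast
  then show "(zorn.siegel_group :: ('a zorn \<Rightarrow> 'a zorn) set) \<subseteq> generate zorn.OG zorn_translations"
    using zorn.siegel_group_le_reflection_products by blast
qed

section \<open>The action on the Paige loop\<close>

text \<open>The normal subgroups of the quotient pull back to those of \<open>G\<close>.\<close>

lemma (in normal) is_simple_group_Mod:
  assumes proper: "H \<noteq> carrier G"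
    and minimal: "\<And>K. K \<lhd> G \<Longrightarrow> \<not> K \<subseteq> H \<Longrightarrow> K = carrier G"
  shows "is_simple_group (G Mod H)"
  unfolding is_simple_group_def
proof (intro conjI allI impI)
  show grp: "group (G Mod H)"
    by (rule factorgroup_is_group)
  interpret Q: group_hom G "G Mod H" "\<lambda>a. H #> a"
    using grp r_coset_hom_Mod by (simp add: group_hom_def group_hom_axioms_def)
  have one: "\<one>\<^bsub>G Mod H\<^esub> = H"
    by (simp add: FactGroup_def)
  have car: "carrier (G Mod H) = (\<lambda>a. H #> a) ` carrier G"
    by (auto simp: FactGroup_def RCOSETS_def)
  show "carrier (G Mod H) \<noteq> {\<one>\<^bsub>G Mod H\<^esub>}"
  proof
    assume "carrier (G Mod H) = {\<one>\<^bsub>G Mod H\<^esub>}"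
    then have "H #> a = H" if "a \<in> carrier G" for a
      using that one car by auto
    then have "carrier G \<subseteq> H"
      using rcos_self[OF _ subgroup_axioms] by blast
    with proper show False
      using subset by blast
  qed
  fix N assume N: "N \<lhd> G Mod H"
  interpret N: normal N "G Mod H"
    by (rule N)
  define K where "K = {a \<in> carrier G. H #> a \<in> N}"
  have K: "K \<lhd> G"
  proof (rule normal_invI)
    show "subgroup K G"
    proof (rule subgroupI)
      show "K \<subseteq> carrier G"
        by (auto simp: K_def)
      have "\<one> \<in> K"
        using N.one_closed unfolding Q.hom_one[symmetric] by (simp add: K_def)
      then show "K \<noteq> {}"
        by blast
      show "inv a \<in> K" if "a \<in> K" for a
        using that N.m_inv_closed[of "H #> a"] by (simp add: K_def flip: Q.hom_inv)
      show "a \<otimes> b \<in> K" if "a \<in> K" "b \<in> K" for a b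
        using that N.m_closed[of "H #> a" "H #> b"] Q.hom_mult[of a b] by (simp add: K_def)
    qed
    show "x \<otimes> h \<otimes> inv x \<in> K" if "x \<in> carrier G" "h \<in> K" for x h
    proof -
      have "(H #> x) \<otimes>\<^bsub>G Mod H\<^esub> (H #> h) \<otimes>\<^bsub>G Mod H\<^esub> inv\<^bsub>G Mod H\<^esub> (H #> x) \<in> N"
        using that by (intro N.inv_op_closed2) (auto simp: K_def)
      then show ?thesis
        using that by (simp add: K_def Q.hom_mult Q.hom_inv)
    qed
  qed
  have NK: "N = (\<lambda>a. H #> a) ` K"
    using N.subset car by (auto simp: K_def)
  show "N = {\<one>\<^bsub>G Mod H\<^esub>} \<or> N = carrier (G Mod H)"
  proof (cases "K \<subseteq> H")
    case True
    then have "H #> a = H" if "a \<in> K" for a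
      using that coset_join2[of a H] subgroup_axioms subset by blast
    then have "N \<subseteq> {H}"
      using NK by auto
    then show ?thesis
      using N.one_closed one by auto
  next
    case False
    then show ?thesis
      using minimal[OF K] NK car by auto
  qed
qed

text \<open>The cosets of the center, that is, the elements of the Paige loop.\<close>

definition pm_pair :: "'a::field zorn \<Rightarrow> 'a zorn set" where
  "pm_pair x = {x, - x}"

lemma carrier_Paige_loop: "carrier Paige_loop = pm_pair ` {x. zorn_norm x = 1}"
  unfolding Paige_loop_def loop_center_Moufang_M
  by (auto simp: FactGroup_def RCOSETS_def r_coset_def Moufang_M_def pm_pair_def zorn_distrib)

lemma mult_Paige_loop: "pm_pair x \<otimes>\<^bsub>Paige_loop\<^esub> pm_pair y = pm_pair (x * y)"
  by (auto simp: Paige_loop_def FactGroup_def set_mult_def Moufang_M_def pm_pair_def zorn_distrib)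

definition Paige_action :: "('a::field zorn \<Rightarrow> 'a zorn) \<Rightarrow> 'a zorn set \<Rightarrow> 'a zorn set" where
  "Paige_action g = (\<lambda>C\<in>carrier Paige_loop. g ` C)"

lemma image_pm_pair: "g \<in> carrier zorn.OG \<Longrightarrow> g ` pm_pair x = pm_pair (g x)"
  by (simp add: pm_pair_def zorn.OG_minus)

lemma Paige_action_pair:
  assumes "g \<in> carrier zorn.OG" "zorn_norm x = 1"
  shows "Paige_action g (pm_pair x) = pm_pair (g x)"
  using assms by (simp add: Paige_action_def carrier_Paige_loop image_pm_pair)

lemma Paige_action_eqI:
  assumes "h \<in> extensional (carrier Paige_loop)" "g \<in> carrier zorn.OG"
    and "\<And>x. zorn_norm x = 1 \<Longrightarrow> h (pm_pair x) = pm_pair (g x)"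
  shows "Paige_action g = h"
proof (rule extensionalityI[OF _ assms(1)])
  show "Paige_action g \<in> extensional (carrier Paige_loop)"
    by (simp add: Paige_action_def)
  show "Paige_action g C = h C" if "C \<in> carrier Paige_loop" for C
    using that assms by (auto simp: carrier_Paige_loop Paige_action_pair)
qed

lemma Paige_action_in_Bij:
  assumes g: "g \<in> carrier zorn.OG"
  shows "Paige_action g \<in> Bij (carrier Paige_loop)"
proof -
  have gi: "inv\<^bsub>zorn.OG\<^esub> g \<in> carrier zorn.OG"
    using g by simp
  have "bij_betw (Paige_action g) (carrier Paige_loop) (carrier Paige_loop)"
    by (rule bij_betwI[where g = "Paige_action (inv\<^bsub>zorn.OG\<^esub> g)"])
      (use g gi in \<open>auto simp: carrier_Paige_loop Paige_action_pair zorn.OG_norm\<close>)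
  then show ?thesis
    by (simp add: Bij_def Paige_action_def)
qed

lemma group_hom_Paige_action:
  "group_hom zorn.OG (BijGroup (carrier Paige_loop)) Paige_action"
proof (intro group_hom.intro group_hom_axioms.intro zorn.group_OG group_BijGroup homI)
  show "Paige_action g \<in> carrier (BijGroup (carrier Paige_loop))" if "g \<in> carrier zorn.OG"
    for g :: "'a zorn \<Rightarrow> 'a zorn"
    using that Paige_action_in_Bij by (simp add: BijGroup_def)
  show "Paige_action (g \<otimes>\<^bsub>zorn.OG\<^esub> h)
      = Paige_action g \<otimes>\<^bsub>BijGroup (carrier Paige_loop)\<^esub> Paige_action h"
    if gh: "g \<in> carrier zorn.OG" "h \<in> carrier zorn.OG" for g h :: "'a zorn \<Rightarrow> 'a zorn"
  proof -
    have "Paige_action (g \<circ> h) = compose (carrier Paige_loop) (Paige_action g) (Paige_action h)"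
      using gh zorn.OG_comp[OF gh]
      by (intro Paige_action_eqI)
        (auto simp: compose_def carrier_Paige_loop Paige_action_pair zorn.OG_norm)
    then show ?thesis
      using gh by (simp add: BijGroup_def Paige_action_in_Bij)
  qed
qed

lemma Paige_action_translations:
  "Paige_action ` zorn_translations
   = left_translation Paige_loop ` carrier Paige_loop \<union> right_translation Paige_loop ` carrier Paige_loop"
proof -
  have l: "Paige_action ((*) x) = left_translation Paige_loop (pm_pair x)"
    and r: "Paige_action (\<lambda>y. y * x) = right_translation Paige_loop (pm_pair x)"
    if "zorn_norm x = 1" for x :: "'a zorn"
    using that left_mult_in_OG[OF that] right_mult_in_OG[OF that]
    by (auto intro!: Paige_action_eqI
        simp: left_translation_def right_translation_def carrier_Paige_loop mult_Paige_loop)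
  have "Paige_action ` zorn_translations
      = (\<lambda>x. Paige_action ((*) x)) ` {x. zorn_norm x = 1} \<union>
        (\<lambda>x. Paige_action (\<lambda>y. y * x)) ` {x :: 'a zorn. zorn_norm x = 1}"
    unfolding zorn_translations_def by blast
  also have "\<dots> = (\<lambda>x. left_translation Paige_loop (pm_pair x)) ` {x. zorn_norm x = 1} \<union>
        (\<lambda>x. right_translation Paige_loop (pm_pair x)) ` {x :: 'a zorn. zorn_norm x = 1}"
    using l r by (auto simp: image_iff)
  finally show ?thesis
    by (simp add: carrier_Paige_loop image_image)
qed

text \<open>Decompose elements of norm 1 as \<open>1 + v\<close>, with \<open>v\<close> an off-diagonal vector, or \<open>e 0\<close> plus an off-diagonal
  vector that is already known to be fixed.  A minus sign on \<open>1 + v\<close> would determine the image of the singular vector in question, and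
  comparing norms gives \<open>2 = 0\<close>; but then that image is the vector itself.\<close>

lemma fixes_norm_one_up_to_sign:
  fixes g :: "'a::field zorn \<Rightarrow> 'a zorn"
  assumes g: "g \<in> carrier zorn.OG" and one: "g 1 = 1"
    and pm: "\<And>x. zorn_norm x = 1 \<Longrightarrow> g x = x \<or> g x = - x"
  shows "g = id"
proof -
  have char2: "- a = a" if "(2 :: 'a) = 0" for a :: 'a
    using that by (metis add_eq_0_iff mult_2 mult_zero_left)
  have four: "(2 :: 'a) = 0" if "(4 :: 'a) = 0"
  proof -
    have "(2 :: 'a) * 2 = 4"
      by simp
    with that show ?thesis
      by (metis mult_eq_0_iff)
  qed
  have shift: "g v = v \<or> g v = - (1 + v) - 1" if "zorn_norm (1 + v) = 1" for v
    using pm[OF that] zorn.OG_add[OF g, of 1 v] one by (auto simp: algebra_simps)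
  have upper: "g (Zorn 0 \<alpha> 0 0) = Zorn 0 \<alpha> 0 0" for \<alpha>
  proof (rule ccontr)
    assume no: "g (Zorn 0 \<alpha> 0 0) \<noteq> Zorn 0 \<alpha> 0 0"
    then have e: "g (Zorn 0 \<alpha> 0 0) = Zorn (- 2) (- \<alpha>) 0 (- 2)"
      using shift[of "Zorn 0 \<alpha> 0 0"] by (simp add: one_zorn_def zorn_coords)
    have "zorn_norm (g (Zorn 0 \<alpha> 0 0)) = 0"
      unfolding zorn.OG_norm[OF g] by (simp add: zorn_coords)
    then have "(2 :: 'a) = 0"
      unfolding e by (simp add: zorn_coords four)
    with no e show False
      using char2 by (simp add: vec_eq_iff)
  qed
  have lower: "g (Zorn 0 0 \<beta> 0) = Zorn 0 0 \<beta> 0" for \<beta>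
  proof (rule ccontr)
    assume no: "g (Zorn 0 0 \<beta> 0) \<noteq> Zorn 0 0 \<beta> 0"
    then have e: "g (Zorn 0 0 \<beta> 0) = Zorn (- 2) 0 (- \<beta>) (- 2)"
      using shift[of "Zorn 0 0 \<beta> 0"] by (simp add: one_zorn_def zorn_coords)
    have "zorn_norm (g (Zorn 0 0 \<beta> 0)) = 0"
      unfolding zorn.OG_norm[OF g] by (simp add: zorn_coords)
    then have "(2 :: 'a) = 0"
      unfolding e by (simp add: zorn_coords four)
    with no e show False
      using char2 by (simp add: vec_eq_iff)
  qed
  have e1: "g (Zorn 1 0 0 0) = Zorn 1 0 0 0"
  proof (rule ccontr)
    assume no: "g (Zorn 1 0 0 0) \<noteq> Zorn 1 0 0 0"
    define \<alpha> :: "'a ^ 3" where "\<alpha> = axis 1 1"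
    define w where "w = Zorn 0 \<alpha> 0 0 + Zorn 0 0 \<alpha> 0"
    have "zorn_norm (1 + (Zorn 1 0 0 0 + w)) = 1"
      by (simp add: w_def \<alpha>_def one_zorn_def zorn_coords axis_def)
    moreover have "g (Zorn 1 0 0 0 + w) = g (Zorn 1 0 0 0) + w"
      unfolding w_def zorn.OG_add[OF g] upper lower ..
    ultimately have "g (Zorn 1 0 0 0) + w = - (1 + (Zorn 1 0 0 0 + w)) - 1"
      using shift no by (metis add_right_imp_eq)
    then have "g (Zorn 1 0 0 0) = - (1 + (Zorn 1 0 0 0 + w)) - 1 - w"
      by (metis add_diff_cancel_right')
    then have e: "g (Zorn 1 0 0 0) = Zorn (- 3) (- 2 *s \<alpha>) (- 2 *s \<alpha>) (- 2)"
      by (simp add: w_def \<alpha>_def one_zorn_def zorn_coords)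
    have "zorn_norm (g (Zorn 1 0 0 0)) = 0"
      unfolding zorn.OG_norm[OF g] by (simp add: zorn_coords)
    then have two: "(2 :: 'a) = 0"
      unfolding e by (simp add: \<alpha>_def zorn_coords axis_def)
    then have "(- 3 :: 'a) = 1"
      using char2[of 1] by (metis add.inverse_inverse add_0 numeral_plus_one one_plus_numeral
          add_cancel_right_left numeral_3_eq_3 one_add_one semiring_norm(5))
    with no e two show False
      by (simp add: vec_eq_iff)
  qed
  have "Zorn 0 0 0 1 = 1 - Zorn 1 0 0 (0 :: 'a)"
    by (simp add: one_zorn_def)
  then have e2: "g (Zorn 0 0 0 1) = Zorn 0 0 0 1"
    using zorn.OG_diff[OF g, of 1 "Zorn 1 0 0 0"] e1 one by simp
  show ?thesis
    by (rule zorn.OG_ext[OF g])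
      (use zorn.OG.one_closed in \<open>simp_all add: zorn_e_def zorn_f_def e1 e2 upper lower\<close>)
qed

lemma uminus_in_OG: "uminus \<in> carrier (zorn.OG :: ('a::field zorn \<Rightarrow> 'a zorn) monoid)"
  unfolding zorn.carrier_OG_iff
  by (auto simp: zorn.N_minus intro!: o_bij[of uminus])

lemma pm_id_if_preserves_pairs:
  fixes g :: "'a::field zorn \<Rightarrow> 'a zorn"
  assumes g: "g \<in> carrier zorn.OG" and pm: "\<And>x. zorn_norm x = 1 \<Longrightarrow> pm_pair (g x) = pm_pair x"
  shows "g = id \<or> g = uminus"
proof -
  have pm': "g x = x \<or> g x = - x" if "zorn_norm x = 1" for x
    using pm[OF that] by (auto simp: pm_pair_def doubleton_eq_iff)
  show ?thesis
  proof (cases "g 1 = 1")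
    case True
    then show ?thesis
      using fixes_norm_one_up_to_sign[OF g] pm' by blast
  next
    case False
    then have "(uminus \<circ> g) 1 = 1"
      using pm'[OF norm_one] by auto
    then have "uminus \<circ> g = id"
      using fixes_norm_one_up_to_sign[OF zorn.OG_comp[OF uminus_in_OG g]] pm' by fastforce
    then have "g = uminus"
      by (metis comp_apply ext id_apply minus_minus)
    then show ?thesis ..
  qed
qed

lemma uminus_in_siegel_group: "uminus \<in> (zorn.siegel_group :: ('a::field zorn \<Rightarrow> 'a zorn) set)"
proof -
  have "zorn_norm (- 1 :: 'a zorn) = 1"
    by (simp add: zorn.N_minus norm_one)
  moreover have "(*) (- 1 :: 'a zorn) = uminus"
    by (auto simp: zorn_distrib)
  ultimately show ?thesis
    using left_mult_in_siegel_group by metis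
qed


section \<open>The multiplication group\<close>

text \<open>From here on, \<open>Omega\<close> is handled as the Siegel group, which is accessible by its generators.\<close>

lemma Omega_zorn:
  "Omega zorn_scale (zorn_norm :: 'a::field zorn \<Rightarrow> 'a) = zorn.OG\<lparr>carrier := zorn.siegel_group\<rparr>"
  by (simp add: Omega_def zorn.derived_eq_siegel_group)

lemma carrier_Mlt_Paige_loop:
  "carrier (Mlt (Paige_loop :: 'a::field zorn set monoid)) = Paige_action ` zorn.siegel_group"
proof -
  interpret act: group_hom "zorn.OG :: ('a zorn \<Rightarrow> 'a zorn) monoid"
    "BijGroup (carrier Paige_loop)" Paige_action
    by (rule group_hom_Paige_action)
  show ?thesis
    using act.generate_img[OF zorn_translations_in_OG]
    by (simp add: Mlt_def Paige_action_translations generate_zorn_translations)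
qed

lemma group_hom_Omega_Mlt:
  "group_hom (Omega zorn_scale (zorn_norm :: 'a::field zorn \<Rightarrow> 'a)) (Mlt Paige_loop) Paige_action"
proof (intro group_hom.intro group_hom_axioms.intro homI)
  interpret act: group_hom "zorn.OG :: ('a zorn \<Rightarrow> 'a zorn) monoid"
    "BijGroup (carrier Paige_loop)" Paige_action
    by (rule group_hom_Paige_action)
  show "group (Omega zorn_scale (zorn_norm :: 'a zorn \<Rightarrow> 'a))"
    unfolding Omega_zorn by (rule zorn.OG.subgroup_imp_group[OF zorn.SG.subgroup_axioms])
  have "subgroup (carrier (Mlt (Paige_loop :: 'a zorn set monoid))) (BijGroup (carrier Paige_loop))"
    unfolding carrier_Mlt_Paige_loop
    by (rule act.subgroup_img_is_subgroup[OF zorn.SG.subgroup_axioms])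
  then show "group (Mlt (Paige_loop :: 'a zorn set monoid))"
    using group.subgroup_imp_group[OF group_BijGroup] by (fastforce simp: Mlt_def)
  fix g h :: "'a zorn \<Rightarrow> 'a zorn"
  assume g: "g \<in> carrier (Omega zorn_scale (zorn_norm :: 'a zorn \<Rightarrow> 'a))"
  then show "Paige_action g \<in> carrier (Mlt Paige_loop)"
    by (simp add: Omega_zorn carrier_Mlt_Paige_loop)
  assume h: "h \<in> carrier (Omega zorn_scale (zorn_norm :: 'a zorn \<Rightarrow> 'a))"
  show "Paige_action (g \<otimes>\<^bsub>Omega zorn_scale zorn_norm\<^esub> h)
      = Paige_action g \<otimes>\<^bsub>Mlt Paige_loop\<^esub> Paige_action h"
    using act.hom_mult[of g h] g h zorn.siegel_group_in_OG by (simp add: Omega_zorn Mlt_def)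
qed

lemma kernel_Paige_action:
  "kernel (Omega zorn_scale (zorn_norm :: 'a::field zorn \<Rightarrow> 'a)) (Mlt Paige_loop) Paige_action
    = {id, uminus}"
proof -
  have one: "\<one>\<^bsub>Mlt Paige_loop\<^esub> = (\<lambda>C\<in>carrier (Paige_loop :: 'a zorn set monoid). C)"
    by (simp add: Mlt_def BijGroup_def)
  have "Paige_action g = \<one>\<^bsub>Mlt Paige_loop\<^esub> \<longleftrightarrow> g = id \<or> g = uminus"
    if g: "g \<in> carrier zorn.OG" for g :: "'a zorn \<Rightarrow> 'a zorn"
  proof
    assume eq: "Paige_action g = \<one>\<^bsub>Mlt Paige_loop\<^esub>"
    have "pm_pair (g x) = pm_pair x" if x: "zorn_norm x = 1" for x
      using fun_cong[OF eq, of "pm_pair x"] Paige_action_pair[OF g x] x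
      by (simp add: one carrier_Paige_loop)
    then show "g = id \<or> g = uminus"
      by (rule pm_id_if_preserves_pairs[OF g])
  next
    assume "g = id \<or> g = uminus"
    then show "Paige_action g = \<one>\<^bsub>Mlt Paige_loop\<^esub>"
      unfolding one using g
      by (intro Paige_action_eqI) (auto simp: carrier_Paige_loop pm_pair_def)
  qed
  then show ?thesis
    using zorn.siegel_group_in_OG uminus_in_siegel_group zorn.SG.one_closed
    by (auto simp: kernel_def Omega_zorn)
qed

lemma scalar_isometry:
  fixes g :: "'a::field zorn \<Rightarrow> 'a zorn"
  assumes g: "g \<in> carrier zorn.OG" and c: "\<And>v. g v = zorn_scale c v"
  shows "g = id \<or> g = uminus"
proof -
  have "c\<^sup>2 = 1"
    using zorn.OG_norm[OF g, of 1] by (simp add: c zorn.N_scale norm_one)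
  then have "c = 1 \<or> c = - 1"
    by (simp add: power2_eq_1_iff)
  then show ?thesis
    using c by (auto simp: fun_eq_iff)
qed

lemma siegel_group_not_pm_id: "(zorn.siegel_group :: ('a::field zorn \<Rightarrow> 'a zorn) set) \<noteq> {id, uminus}"
proof
  define g :: "'a zorn \<Rightarrow> 'a zorn" where "g = zorn.siegel (Zorn 1 0 0 0) (Zorn 0 (axis 1 1) 0 0)"
  have "g \<in> zorn.siegel_group"
    unfolding g_def by (intro zorn.siegel_in_siegel_group) (simp_all add: polar_zorn zorn_coords)
  moreover assume "zorn.siegel_group = {id, uminus :: 'a zorn \<Rightarrow> 'a zorn}"
  ultimately have "g (Zorn 0 0 0 1) = Zorn 0 0 0 1 \<or> g (Zorn 0 0 0 1) = - Zorn 0 0 0 1"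
    by auto
  then show False
    by (auto simp: g_def zorn.siegel_def polar_zorn zorn_coords axis_def)
qed

theorem corollary4p7:
  shows "Mlt (Paige_loop :: 'a::field zorn set monoid) \<cong>
           POmega (zorn_scale :: 'a \<Rightarrow> 'a zorn \<Rightarrow> 'a zorn) zorn_norm
       \<and> is_simple_group (POmega (zorn_scale :: 'a \<Rightarrow> 'a zorn \<Rightarrow> 'a zorn) zorn_norm)"
proof
  let ?\<Omega> = "Omega zorn_scale (zorn_norm :: 'a zorn \<Rightarrow> 'a)"
  interpret act: group_hom ?\<Omega> "Mlt (Paige_loop :: 'a zorn set monoid)" Paige_action
    by (rule group_hom_Omega_Mlt)
  have N: "{id, uminus} \<lhd> ?\<Omega>"
    using act.normal_kernel unfolding kernel_Paige_action .
  have "?\<Omega> Mod {id, uminus} \<cong> Mlt (Paige_loop :: 'a zorn set monoid)"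
    using act.FactGroup_iso unfolding kernel_Paige_action
    by (simp add: Omega_zorn carrier_Mlt_Paige_loop)
  then show "Mlt (Paige_loop :: 'a zorn set monoid) \<cong>
      POmega zorn_scale (zorn_norm :: 'a zorn \<Rightarrow> 'a)"
    unfolding POmega_def
    by (rule group.iso_sym[OF normal.factorgroup_is_group[OF N]])
  show "is_simple_group (POmega zorn_scale (zorn_norm :: 'a zorn \<Rightarrow> 'a))"
    unfolding POmega_def
  proof (rule normal.is_simple_group_Mod[OF N])
    show "{id, uminus} \<noteq> carrier ?\<Omega>"
      using siegel_group_not_pm_id by (simp add: Omega_zorn eq_commute)
    fix K assume K: "K \<lhd> ?\<Omega>" and "\<not> K \<subseteq> {id, uminus}"
    then obtain h where h: "h \<in> K" "h \<noteq> id" "h \<noteq> uminus"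
      by blast
    have sub: "subgroup K ?\<Omega>"
      using K by (rule normal_imp_subgroup)
    have KT: "K \<subseteq> zorn.siegel_group"
      using subgroup.subset[OF sub] by (simp add: Omega_zorn)
    have "zorn.siegel_group \<subseteq> K"
    proof (rule zorn.siegel_group_minimal)
      show "subgroup K zorn.OG"
        using zorn.OG.incl_subgroup[OF zorn.SG.subgroup_axioms] sub by (simp add: Omega_zorn)
      show "t \<circ> k \<circ> inv\<^bsub>zorn.OG\<^esub> t \<in> K" if "t \<in> zorn.siegel_group" "k \<in> K" for t k
        using normal.inv_op_closed2[OF K, of t k] that
          zorn.OG.m_inv_consistent[OF zorn.SG.subgroup_axioms that(1)]
        by (simp add: Omega_zorn)
      show "h \<in> K"
        by (rule h)
      show "\<nexists>c. \<forall>v. h v = zorn_scale c v"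
        using scalar_isometry[of h] h KT zorn.siegel_group_in_OG by blast
    qed
    with KT show "K = carrier ?\<Omega>"
      by (simp add: Omega_zorn)
  qed
qed

end
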